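(* Every AT-free outerplanar graph is $B_0$-VPG.
   Context: All graphs are finite and simple. An asteroidal triple (AT) is a set of three pairwise nonadjacent vertices such that between any two of them there is a path avoiding the closed neighborhood of the third; a graph is AT-free if it has no AT. An outerplanar graph is a planar graph with a plane embedding having all vertices on the outer face. A graph is $B_0$-VPG if it is the intersection graph of a family of horizontal or vertical line segments in the plane (point segments allowed): vertices correspond to segments, adjacent iff the segments intersect. *)

theory Defs
  imports "HOL-Analysis.Analysis" "Graph_Theory.Pair_Digraph" "Graph_Theory.Vertex_Walk"
begin

text \<open>Finite simple graphs are symmetric loop-free pair digraphs, i.e. those \<open>G\<close> with
  \<^term>\<open>pair_graph G\<close>; an undirected edge \<open>uv\<close> is the pair of arcs \<open>(u, v)\<close>, \<open>(v, u)\<close>.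
  The plane is the type \<^typ>\<open>complex\<close>.\<close>

definition closed_nbhd :: "'a pair_pre_digraph \<Rightarrow> 'a \<Rightarrow> 'a set" where
  "closed_nbhd G w = insert w {x. (w, x) \<in> parcs G}"

definition path_avoiding_nbhd :: "'a pair_pre_digraph \<Rightarrow> 'a \<Rightarrow> 'a \<Rightarrow> 'a \<Rightarrow> bool" where
  "path_avoiding_nbhd G u v w \<longleftrightarrow>
     (\<exists>p. vpath p (with_proj G) \<and> hd p = u \<and> last p = v \<and> set p \<inter> closed_nbhd G w = {})"

definition asteroidal_triple :: "'a pair_pre_digraph \<Rightarrow> 'a \<Rightarrow> 'a \<Rightarrow> 'a \<Rightarrow> bool" where
  "asteroidal_triple G a b c \<longleftrightarrow>
     {a, b, c} \<subseteq> pverts G \<and> distinct [a, b, c] \<and>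
     (a, b) \<notin> parcs G \<and> (b, c) \<notin> parcs G \<and> (a, c) \<notin> parcs G \<and>
     path_avoiding_nbhd G a b c \<and> path_avoiding_nbhd G b c a \<and> path_avoiding_nbhd G a c b"

definition AT_free :: "'a pair_pre_digraph \<Rightarrow> bool" where
  "AT_free G \<longleftrightarrow> (\<nexists>a b c. asteroidal_triple G a b c)"

text \<open>The two arcs of an undirected edge are drawn as the same curve, traversed in opposite
  directions.\<close>

definition plane_embedding ::
    "'a pair_pre_digraph \<Rightarrow> ('a \<Rightarrow> complex) \<Rightarrow> ('a \<times> 'a \<Rightarrow> real \<Rightarrow> complex) \<Rightarrow> bool" where
  "plane_embedding G pos \<gamma> \<longleftrightarrow>
     inj_on pos (pverts G) \<and>
     (\<forall>(u, v) \<in> parcs G.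
        arc (\<gamma> (u, v)) \<and> pathstart (\<gamma> (u, v)) = pos u \<and> pathfinish (\<gamma> (u, v)) = pos v \<and>
        \<gamma> (v, u) = reversepath (\<gamma> (u, v)) \<and>
        path_image (\<gamma> (u, v)) \<inter> pos ` pverts G = {pos u, pos v}) \<and>
     (\<forall>(u, v) \<in> parcs G. \<forall>(x, y) \<in> parcs G. {u, v} \<noteq> {x, y} \<longrightarrow>
        path_image (\<gamma> (u, v)) \<inter> path_image (\<gamma> (x, y)) \<subseteq> pos ` ({u, v} \<inter> {x, y}))"

definition drawing ::
    "'a pair_pre_digraph \<Rightarrow> ('a \<Rightarrow> complex) \<Rightarrow> ('a \<times> 'a \<Rightarrow> real \<Rightarrow> complex) \<Rightarrow> complex set" where
  "drawing G pos \<gamma> = pos ` pverts G \<union> (\<Union>e \<in> parcs G. path_image (\<gamma> e))"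

text \<open>The drawing of a finite graph is compact, so \<^const>\<open>outside\<close> of it is its unique unbounded
  face; a vertex lies on a face if it belongs to the boundary of that face.\<close>

definition outerplanar :: "'a pair_pre_digraph \<Rightarrow> bool" where
  "outerplanar G \<longleftrightarrow>
     (\<exists>pos \<gamma>. plane_embedding G pos \<gamma> \<and>
        pos ` pverts G \<subseteq> frontier (outside (drawing G pos \<gamma>)))"

definition horizontal_segment :: "complex set \<Rightarrow> bool" where
  "horizontal_segment S \<longleftrightarrow> (\<exists>a b. Im a = Im b \<and> S = closed_segment a b)"

definition vertical_segment :: "complex set \<Rightarrow> bool" where
  "vertical_segment S \<longleftrightarrow> (\<exists>a b. Re a = Re b \<and> S = closed_segment a b)"

definition B0_VPG :: "'a pair_pre_digraph \<Rightarrow> bool" where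
  "B0_VPG G \<longleftrightarrow>
     (\<exists>S. (\<forall>v \<in> pverts G. horizontal_segment (S v) \<or> vertical_segment (S v)) \<and>
        (\<forall>u \<in> pverts G. \<forall>v \<in> pverts G. u \<noteq> v \<longrightarrow>
           ((u, v) \<in> parcs G \<longleftrightarrow> S u \<inter> S v \<noteq> {})))"

end

theory Submission
  imports Defs
begin

text \<open>
  An outerplane graph contains no three internally disjoint paths with common ends and at least
  one inner vertex each, since by Janiszewski's theorem one of them would run inside the closed
  curve formed by the other two; hence there is no \<open>K\<^bsub>2,3\<^esub>\<close> minor. Similarly there is no \<open>K\<^bsub>4\<^esub>\<close>, because
  two chords of a closed curve with interleaved ends cross.

  Call \<open>s\<close> admissible if no two vertices \<open>y\<close>, \<open>z\<close> are such that \<open>s\<close> reaches \<open>y\<close> outside the closed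
  neighbourhood of \<open>z\<close> and reaches \<open>z\<close> outside that of \<open>y\<close>. Every graph without asteroidal triple
  has an admissible vertex. Sweeping the graph from such a vertex, one can add the vertices one by
  one so that at any time at most two vertices \<open>t\<close>, \<open>b\<close> of the processed part have unprocessed
  neighbours, each new vertex replacing \<open>t\<close> or \<open>b\<close>: the sweep gets stuck only if both have two
  unprocessed neighbours, and that violates admissibility or yields a \<open>K\<^bsub>2,3\<^esub>\<close> minor.

  Such a sweep is drawn from left to right, keeping the segments of \<open>t\<close> and \<open>b\<close> extendable.
\<close>

section \<open>Drawings by axis-parallel segments\<close>

datatype rect = Rect (xmin: real) (xmax: real) (ymin: real) (ymax: real)

definition horizontal :: "rect \<Rightarrow> bool" where
  "horizontal A \<longleftrightarrow> xmin A \<le> xmax A \<and> ymin A = ymax A"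

definition vertical :: "rect \<Rightarrow> bool" where
  "vertical A \<longleftrightarrow> xmin A = xmax A \<and> ymin A \<le> ymax A"

definition meets :: "rect \<Rightarrow> rect \<Rightarrow> bool" where
  "meets A B \<longleftrightarrow> xmin A \<le> xmax B \<and> xmin B \<le> xmax A \<and> ymin A \<le> ymax B \<and> ymin B \<le> ymax A"

definition segment_rep :: "('b \<Rightarrow> 'b \<Rightarrow> bool) \<Rightarrow> 'b set \<Rightarrow> ('b \<Rightarrow> rect) \<Rightarrow> bool" where
  "segment_rep E W S \<longleftrightarrow> (\<forall>w\<in>W. horizontal (S w) \<or> vertical (S w)) \<and>
     (\<forall>v\<in>W. \<forall>w\<in>W. v \<noteq> w \<longrightarrow> (E v w \<longleftrightarrow> meets (S v) (S w)))"

definition extend_right :: "real \<Rightarrow> rect \<Rightarrow> rect" where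
  "extend_right M A = Rect (xmin A) M (ymin A) (ymax A)"

definition crosses_right_ray :: "real \<Rightarrow> real \<Rightarrow> rect \<Rightarrow> bool" where
  "crosses_right_ray x y A \<longleftrightarrow> x \<le> xmax A \<and> ymin A \<le> y \<and> y \<le> ymax A"

definition crosses_down_ray :: "real \<Rightarrow> real \<Rightarrow> rect \<Rightarrow> bool" where
  "crosses_down_ray x y A \<longleftrightarrow> xmin A \<le> x \<and> x \<le> xmax A \<and> ymin A \<le> y"

definition flip_vertically :: "rect \<Rightarrow> rect" where
  "flip_vertically A = Rect (xmin A) (xmax A) (- ymax A) (- ymin A)"

text \<open>The reflection in the antidiagonal exchanges the directions right and down.\<close>

definition reflect :: "rect \<Rightarrow> rect" where
  "reflect A = Rect (- ymax A) (- ymin A) (- xmax A) (- xmin A)"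

lemma rect_sel_simps [simp]:
  "xmin (extend_right M A) = xmin A" "xmax (extend_right M A) = M"
  "ymin (extend_right M A) = ymin A" "ymax (extend_right M A) = ymax A"
  "xmin (flip_vertically A) = xmin A" "xmax (flip_vertically A) = xmax A"
  "ymin (flip_vertically A) = - ymax A" "ymax (flip_vertically A) = - ymin A"
  "xmin (reflect A) = - ymax A" "xmax (reflect A) = - ymin A"
  "ymin (reflect A) = - xmax A" "ymax (reflect A) = - xmin A"
  by (simp_all add: extend_right_def flip_vertically_def reflect_def)

lemma meets_commute: "meets A B \<longleftrightarrow> meets B A"
  by (auto simp: meets_def)

lemma horizontal_flip_vertically [simp]: "horizontal (flip_vertically A) \<longleftrightarrow> horizontal A"
  by (auto simp: horizontal_def)

lemma horizontal_reflect [simp]: "horizontal (reflect A) \<longleftrightarrow> vertical A"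
  by (auto simp: horizontal_def vertical_def)

lemma vertical_reflect [simp]: "vertical (reflect A) \<longleftrightarrow> horizontal A"
  by (auto simp: horizontal_def vertical_def)

lemma crosses_right_ray_reflect [simp]:
  "crosses_right_ray (- y) (- x) (reflect A) \<longleftrightarrow> crosses_down_ray x y A"
  by (auto simp: crosses_right_ray_def crosses_down_ray_def)

lemma crosses_down_ray_reflect [simp]:
  "crosses_down_ray (- y) (- x) (reflect A) \<longleftrightarrow> crosses_right_ray x y A"
  by (auto simp: crosses_right_ray_def crosses_down_ray_def)

lemma segment_rep_mono: "segment_rep E W S \<Longrightarrow> W' \<subseteq> W \<Longrightarrow> segment_rep E W' S"
  by (auto simp: segment_rep_def subset_iff)

lemma segment_rep_wf:
  assumes "segment_rep E W S" "w \<in> W"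
  shows "xmin (S w) \<le> xmax (S w)" "ymin (S w) \<le> ymax (S w)"
  using assms by (auto simp: segment_rep_def horizontal_def vertical_def)

lemma adjacent_iff_meets:
  "segment_rep E W S \<Longrightarrow> v \<in> W \<Longrightarrow> w \<in> W \<Longrightarrow> v \<noteq> w \<Longrightarrow> E v w \<longleftrightarrow> meets (S v) (S w)"
  by (simp add: segment_rep_def)

lemma segment_rep_flip_vertically: "segment_rep E W S \<Longrightarrow> segment_rep E W (flip_vertically \<circ> S)"
  by (auto simp: segment_rep_def horizontal_def vertical_def meets_def)

lemma segment_rep_reflect: "segment_rep E W S \<Longrightarrow> segment_rep E W (reflect \<circ> S)"
  by (auto simp: segment_rep_def meets_def)

lemma segment_rep_insert:
  assumes "segment_rep E W S" "v \<notin> W" "symp E" "horizontal A \<or> vertical A"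
    and "\<And>w. w \<in> W \<Longrightarrow> E v w \<longleftrightarrow> meets A (S w)"
  shows "segment_rep E (insert v W) (S(v := A))"
  using assms sympD[OF assms(3)] unfolding segment_rep_def
  by (auto simp: meets_commute[of _ A])

lemma segment_rep_extend_right:
  assumes rep: "segment_rep E W S" and "symp E" and b: "b \<in> W" "horizontal (S b)" "xmax (S b) \<le> M"
    and ray: "\<And>w. w \<in> W - {b} \<Longrightarrow> crosses_right_ray (xmax (S b)) (ymin (S b)) (S w) \<Longrightarrow> E b w"
  shows "segment_rep E W (S(b := extend_right M (S b)))"
proof -
  have adj: "E b w \<longleftrightarrow> meets (extend_right M (S b)) (S w)" if "w \<in> W - {b}" for w
  proof -
    have "E b w \<longleftrightarrow> meets (S b) (S w)" using adjacent_iff_meets[OF rep] b that by blast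
    then show ?thesis
      using ray[OF that] b segment_rep_wf[OF rep, of w] that
      by (auto simp: meets_def crosses_right_ray_def horizontal_def)
  qed
  moreover have "E w b \<longleftrightarrow> meets (S w) (extend_right M (S b))" if "w \<in> W - {b}" for w
    using adj[OF that] \<open>symp E\<close> by (auto simp: meets_commute dest: sympD)
  moreover have "horizontal (extend_right M (S b))" using b by (simp add: horizontal_def)
  ultimately show ?thesis using rep unfolding segment_rep_def by auto
qed

text \<open>The forms below describe in which ways the segments of the two active vertices \<open>t\<close>, \<open>b\<close> can
  still be extended. Pairwise intersecting segments have a common point, so a new vertex adjacent to
  both of two adjacent vertices has to cover a common point of their segments, and it has to leave
  that point to the right or downwards in order to stay extendable. Conversely, a vertex adjacent to
  \<open>t\<close> but not to \<open>b\<close> cannot be added when both are collinear. This is why \<open>drawable\<close> asks for two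
  different drawings when \<open>t\<close> and \<open>b\<close> are adjacent.\<close>

definition right_form :: "('b \<Rightarrow> 'b \<Rightarrow> bool) \<Rightarrow> 'b set \<Rightarrow> ('b \<Rightarrow> rect) \<Rightarrow> 'b \<Rightarrow> bool" where
  "right_form E W S b \<longleftrightarrow> segment_rep E W S \<and> b \<in> W \<and> horizontal (S b) \<and>
     (\<forall>w\<in>W - {b}. xmax (S w) < xmax (S b))"

definition parallel_form :: "('b \<Rightarrow> 'b \<Rightarrow> bool) \<Rightarrow> 'b set \<Rightarrow> ('b \<Rightarrow> rect) \<Rightarrow> 'b \<Rightarrow> 'b \<Rightarrow> bool" where
  "parallel_form E W S t b \<longleftrightarrow> segment_rep E W S \<and> t \<in> W \<and> b \<in> W \<and> t \<noteq> b \<and>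
     horizontal (S t) \<and> horizontal (S b) \<and> xmax (S t) = xmax (S b) \<and>
     (\<forall>w\<in>W - {t, b}. xmax (S w) < xmax (S b))"

definition corner_form :: "('b \<Rightarrow> 'b \<Rightarrow> bool) \<Rightarrow> 'b set \<Rightarrow> ('b \<Rightarrow> rect) \<Rightarrow> 'b \<Rightarrow> 'b \<Rightarrow> bool" where
  "corner_form E W S t b \<longleftrightarrow> segment_rep E W S \<and> t \<in> W \<and> b \<in> W \<and> t \<noteq> b \<and>
     vertical (S t) \<and> horizontal (S b) \<and>
     (\<forall>w\<in>W - {b}. xmax (S w) < xmax (S b)) \<and> (\<forall>w\<in>W - {t}. ymin (S t) < ymin (S w))"

definition common_end_form :: "('b \<Rightarrow> 'b \<Rightarrow> bool) \<Rightarrow> 'b set \<Rightarrow> ('b \<Rightarrow> rect) \<Rightarrow> 'b \<Rightarrow> 'b \<Rightarrow> bool" where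
  "common_end_form E W S t b \<longleftrightarrow> segment_rep E W S \<and> t \<in> W \<and> b \<in> W \<and> t \<noteq> b \<and>
     xmax (S t) = xmax (S b) \<and> ymin (S t) = ymin (S b) \<and>
     (\<forall>w\<in>W - {t, b}. \<not> crosses_right_ray (xmax (S b)) (ymin (S b)) (S w) \<and>
        \<not> crosses_down_ray (xmax (S b)) (ymin (S b)) (S w))"

definition drawable :: "('b \<Rightarrow> 'b \<Rightarrow> bool) \<Rightarrow> 'b set \<Rightarrow> 'b \<Rightarrow> 'b \<Rightarrow> bool" where
  "drawable E W t b \<longleftrightarrow>
     (if E t b then (\<exists>S. common_end_form E W S t b) \<and> (\<exists>S. corner_form E W S t b)
      else \<exists>S. parallel_form E W S t b)"

lemma right_form_xmax_less:
  "right_form E W S b \<Longrightarrow> w \<in> W \<Longrightarrow> w \<noteq> b \<Longrightarrow> xmax (S w) < xmax (S b)"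
  by (simp add: right_form_def)

lemma parallel_form_xmax_less:
  "parallel_form E W S t b \<Longrightarrow> w \<in> W \<Longrightarrow> w \<noteq> t \<Longrightarrow> w \<noteq> b \<Longrightarrow> xmax (S w) < xmax (S b)"
  by (simp add: parallel_form_def)

lemma corner_form_ymin_less:
  "corner_form E W S t b \<Longrightarrow> w \<in> W \<Longrightarrow> w \<noteq> t \<Longrightarrow> ymin (S t) < ymin (S w)"
  by (simp add: corner_form_def)

lemma segment_rep_if_drawable: "drawable E W t b \<Longrightarrow> \<exists>S. segment_rep E W S"
  by (auto simp: drawable_def corner_form_def parallel_form_def split: if_splits)

lemma parallel_form_commute: "parallel_form E W S t b \<Longrightarrow> parallel_form E W S b t"
  by (auto simp: parallel_form_def)

lemma common_end_form_commute: "common_end_form E W S t b \<Longrightarrow> common_end_form E W S b t"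
  by (auto simp: common_end_form_def)

lemma corner_form_reflect: "corner_form E W S t b \<Longrightarrow> corner_form E W (reflect \<circ> S) b t"
  by (auto simp: corner_form_def segment_rep_reflect)

lemma common_end_form_reflect:
  "common_end_form E W S t b \<Longrightarrow> common_end_form E W (reflect \<circ> S) t b"
  by (auto simp: common_end_form_def segment_rep_reflect)

lemma parallel_form_flip_vertically:
  "parallel_form E W S t b \<Longrightarrow> parallel_form E W (flip_vertically \<circ> S) t b"
  by (auto simp: parallel_form_def segment_rep_flip_vertically)

lemma drawable_commute:
  assumes "symp E" "drawable E W t b" shows "drawable E W b t"
proof -
  have "E t b \<longleftrightarrow> E b t" using assms(1) by (auto dest: sympD)
  then show ?thesis
    using assms(2) parallel_form_commute common_end_form_commute corner_form_reflect
    unfolding drawable_def by metis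
qed

lemma parallel_form_ymin_neq:
  assumes "parallel_form E W S t b" "\<not> E t b" shows "ymin (S t) \<noteq> ymin (S b)"
  using assms adjacent_iff_meets[of E W S t b]
  by (auto simp: parallel_form_def meets_def horizontal_def)

lemma right_form_extend_right:
  assumes "segment_rep E W S" "symp E" "b \<in> W" "horizontal (S b)" "xmax (S b) \<le> M"
    and "\<And>w. w \<in> W - {b} \<Longrightarrow> xmax (S w) < M"
    and "\<And>w. w \<in> W - {b} \<Longrightarrow> crosses_right_ray (xmax (S b)) (ymin (S b)) (S w) \<Longrightarrow> E b w"
  shows "right_form E W (S(b := extend_right M (S b))) b"
  using assms(3-6) segment_rep_extend_right[OF assms(1-5,7)]
  by (auto simp: right_form_def horizontal_def)

lemma right_form_extend_if_right_form:
  assumes "right_form E W S b" "symp E" "xmax (S b) \<le> M"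
  shows "right_form E W (S(b := extend_right M (S b))) b"
proof (rule right_form_extend_right)
  fix w assume "w \<in> W - {b}"
  then have "xmax (S w) < xmax (S b)" using right_form_xmax_less[OF assms(1)] by blast
  then show "xmax (S w) < M" "crosses_right_ray (xmax (S b)) (ymin (S b)) (S w) \<Longrightarrow> E b w"
    using assms(3) by (simp_all add: crosses_right_ray_def)
qed (use assms in \<open>auto simp: right_form_def\<close>)

lemma right_form_extend_if_parallel_form:
  assumes form: "parallel_form E W S t b" "\<not> E t b" and "symp E" "xmax (S b) < M"
  shows "right_form E W (S(b := extend_right M (S b))) b"
proof (rule right_form_extend_right)
  fix w assume w: "w \<in> W - {b}" and crosses: "crosses_right_ray (xmax (S b)) (ymin (S b)) (S w)"
  then have "w = t"
    using parallel_form_xmax_less[OF form(1), of w] by (auto simp: crosses_right_ray_def)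
  then have "ymin (S t) = ymin (S b)"
    using form(1) crosses by (simp add: parallel_form_def crosses_right_ray_def horizontal_def)
  then show "E b w" using parallel_form_ymin_neq[OF form] by blast
next
  fix w assume "w \<in> W - {b}"
  then have "xmax (S w) \<le> xmax (S b)"
    using form(1) by (cases "w = t") (auto simp: parallel_form_def less_imp_le)
  then show "xmax (S w) < M" using assms(4) by linarith
qed (use assms in \<open>auto simp: parallel_form_def\<close>)

lemma right_form_extend_if_common_end_form:
  assumes "common_end_form E W S t b" "E t b" "symp E" "horizontal (S b)"
    and "\<forall>w\<in>W. xmax (S w) < M"
  shows "right_form E W (S(b := extend_right M (S b))) b"
proof -
  have "E b t" using assms(2,3) by (blast dest: sympD)
  then show ?thesis
    using assms by (intro right_form_extend_right) (auto simp: common_end_form_def less_imp_le)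
qed

lemma right_form_if_drawable:
  assumes "drawable E W t b" "symp E" shows "\<exists>S. right_form E W S b"
proof (cases "E t b")
  case True
  then show ?thesis using assms(1) by (auto simp: drawable_def corner_form_def right_form_def)
next
  case False
  then obtain S where "parallel_form E W S t b" using assms(1) by (auto simp: drawable_def)
  from right_form_extend_if_parallel_form[OF this False assms(2), of "xmax (S b) + 1"]
  show ?thesis by auto
qed

lemma ex_strict_upper_bound:
  fixes f :: "'b \<Rightarrow> real"
  assumes "finite A" shows "\<exists>M. \<forall>a\<in>A. f a < M"
  using assms
  by (intro exI[of _ "Max (f ` A) + 1"]) (auto intro!: le_less_trans[OF Max_ge less_add_one])

lemma ex_strict_lower_bound:
  fixes f :: "'b \<Rightarrow> real"
  assumes "finite A" shows "\<exists>N. \<forall>a\<in>A. N < f a"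
  using ex_strict_upper_bound[OF assms, of "\<lambda>a. - f a"] by (metis minus_less_iff)

context
  fixes E :: "'b \<Rightarrow> 'b \<Rightarrow> bool" and W :: "'b set" and v :: 'b
  assumes symp_E: "symp E" and fresh: "v \<notin> W"
begin

lemma common_end_form_insert_collinear:
  assumes form: "right_form E W S b" and x: "x \<le> xmax (S b)"
    and adj: "\<And>w. w \<in> W \<Longrightarrow>
      E v w \<longleftrightarrow> meets (Rect x (xmax (S b)) (ymin (S b)) (ymin (S b))) (S w)"
  shows "common_end_form E (insert v W) (S(v := Rect x (xmax (S b)) (ymin (S b)) (ymin (S b)))) v b"
proof -
  let ?A = "Rect x (xmax (S b)) (ymin (S b)) (ymin (S b))"
  have "segment_rep E (insert v W) (S(v := ?A))"
    by (rule segment_rep_insert)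
       (use form x adj symp_E fresh in \<open>auto simp: right_form_def horizontal_def\<close>)
  moreover have "\<not> crosses_right_ray (xmax (S b)) (ymin (S b)) (S w)"
    "\<not> crosses_down_ray (xmax (S b)) (ymin (S b)) (S w)" if "w \<in> W - {b}" for w
    using right_form_xmax_less[OF form, of w] that
    by (simp_all add: crosses_right_ray_def crosses_down_ray_def)
  ultimately show ?thesis using form fresh by (auto simp: right_form_def common_end_form_def)
qed

lemma corner_form_insert_vertical:
  assumes form: "right_form E W S b" and x: "x < xmax (S b)" and y: "ymin (S b) \<le> y"
    and N: "\<forall>w\<in>W. N < ymin (S w)" and adj: "\<And>w. w \<in> W \<Longrightarrow> E v w \<longleftrightarrow> meets (Rect x x N y) (S w)"
  shows "corner_form E (insert v W) (S(v := Rect x x N y)) v b"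
proof -
  have "vertical (Rect x x N y)"
    using form y N by (force simp: right_form_def vertical_def)
  moreover from this have "segment_rep E (insert v W) (S(v := Rect x x N y))"
    by (intro segment_rep_insert) (use form adj symp_E fresh in \<open>auto simp: right_form_def\<close>)
  ultimately show ?thesis using form x N fresh
    by (auto simp: right_form_def corner_form_def)
qed

lemma drawable_insert_isolated:
  assumes form: "right_form E W S b" and nonadj: "\<And>w. w \<in> W \<Longrightarrow> \<not> E v w"
  shows "drawable E (insert v W) v b"
proof -
  let ?A = "Rect (xmax (S b)) (xmax (S b)) (ymin (S b) + 1) (ymin (S b) + 1)"
  have "\<not> meets ?A (S w)" if "w \<in> W" for w
    using form right_form_xmax_less[OF form that]
    by (cases "w = b") (auto simp: right_form_def meets_def horizontal_def)
  then have "segment_rep E (insert v W) (S(v := ?A))"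
    by (intro segment_rep_insert)
       (use form nonadj symp_E fresh in \<open>auto simp: right_form_def horizontal_def\<close>)
  then have "parallel_form E (insert v W) (S(v := ?A)) v b"
    using form fresh by (auto simp: right_form_def parallel_form_def horizontal_def)
  moreover have "\<not> E v b" using form nonadj by (simp add: right_form_def)
  ultimately show ?thesis by (auto simp: drawable_def)
qed

lemma drawable_insert_adjacent_top_if_corner_form:
  assumes form: "corner_form E W S t b" and adj: "\<And>w. w \<in> W \<Longrightarrow> E v w \<longleftrightarrow> w = t"
  shows "drawable E (insert v W) v b"
proof -
  let ?A = "Rect (xmin (S t)) (xmax (S b)) (ymin (S t)) (ymin (S t))"
  note ymin_less = corner_form_ymin_less[OF form] and form = form[unfolded corner_form_def]
  have "xmax (S t) < xmax (S b)" using form by blast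
  moreover have "xmin (S t) = xmax (S t)" using form by (simp add: vertical_def)
  ultimately have "xmin (S t) \<le> xmax (S b)" by linarith
  then have "meets ?A (S w) \<longleftrightarrow> w = t" if "w \<in> W" for w
    using form ymin_less[OF that] segment_rep_wf[OF conjunct1[OF form] that]
    by (cases "w = t") (auto simp: meets_def vertical_def)
  then have "segment_rep E (insert v W) (S(v := ?A))"
    by (intro segment_rep_insert)
       (use form adj symp_E fresh \<open>xmin (S t) \<le> xmax (S b)\<close> in \<open>auto simp: horizontal_def\<close>)
  then have "parallel_form E (insert v W) (S(v := ?A)) v b"
    using form fresh \<open>xmin (S t) \<le> xmax (S b)\<close> by (auto simp: parallel_form_def horizontal_def)
  moreover have "\<not> E v b" using form adj by blast
  ultimately show ?thesis by (auto simp: drawable_def)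
qed

lemma drawable_insert_adjacent_top_if_parallel_form:
  assumes form: "parallel_form E W S t b" "\<not> E t b" and adj: "\<And>w. w \<in> W \<Longrightarrow> E v w \<longleftrightarrow> w = t"
  shows "drawable E (insert v W) v b"
proof -
  define S' where "S' = S(b := extend_right (xmax (S b) + 1) (S b))"
  let ?A = "Rect (xmax (S b)) (xmax (S b) + 1) (ymin (S t)) (ymin (S t))"
  have right: "right_form E W S' b"
    unfolding S'_def using form symp_E by (intro right_form_extend_if_parallel_form) auto
  note ymin_neq = parallel_form_ymin_neq[OF form]
    and xmax_less = parallel_form_xmax_less[OF form(1)]
  note form = form(1)[unfolded parallel_form_def]
  have "meets ?A (S' w) \<longleftrightarrow> w = t" if "w \<in> W" for w
    using form ymin_neq xmax_less[OF that]
    by (cases "w = t"; cases "w = b") (auto simp: S'_def meets_def horizontal_def)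
  then have "segment_rep E (insert v W) (S'(v := ?A))"
    by (intro segment_rep_insert)
       (use right adj symp_E fresh in \<open>auto simp: right_form_def horizontal_def\<close>)
  then have "parallel_form E (insert v W) (S'(v := ?A)) v b"
    using right form fresh by (auto simp: right_form_def parallel_form_def horizontal_def S'_def)
  moreover have "\<not> E v b" using form adj by blast
  ultimately show ?thesis by (auto simp: drawable_def)
qed

lemma drawable_insert_adjacent_bottom:
  assumes "finite W" and form: "right_form E W S b" and adj: "\<And>w. w \<in> W \<Longrightarrow> E v w \<longleftrightarrow> w = b"
  shows "drawable E (insert v W) v b"
proof -
  let ?x = "xmax (S b)" and ?y = "ymin (S b)"
  have "meets (Rect ?x ?x ?y ?y) (S w) \<longleftrightarrow> w = b" if "w \<in> W" for w
    using form right_form_xmax_less[OF form that]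
    by (cases "w = b") (auto simp: right_form_def meets_def horizontal_def)
  then have "common_end_form E (insert v W) (S(v := Rect ?x ?x ?y ?y)) v b"
    by (intro common_end_form_insert_collinear[OF form order_refl]) (simp add: adj)
  moreover
  define S' where "S' = S(b := extend_right (?x + 1) (S b))"
  have right: "right_form E W S' b"
    unfolding S'_def using form symp_E by (intro right_form_extend_if_right_form) auto
  obtain N where N: "\<forall>w\<in>W. N < ymin (S' w)"
    using ex_strict_lower_bound[OF \<open>finite W\<close>, of "\<lambda>w. ymin (S' w)"] by blast
  have "meets (Rect ?x ?x N ?y) (S' w) \<longleftrightarrow> w = b" if "w \<in> W" for w
    using form right_form_xmax_less[OF form that] N[rule_format, OF that]
    by (cases "w = b") (auto simp: right_form_def meets_def horizontal_def S'_def)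
  then have "corner_form E (insert v W) (S'(v := Rect ?x ?x N ?y)) v b"
    by (intro corner_form_insert_vertical[OF right _ _ N]) (use adj in \<open>auto simp: S'_def\<close>)
  moreover have "E v b" using form adj by (simp add: right_form_def)
  ultimately show ?thesis by (auto simp: drawable_def)
qed

lemma ex_common_end_form_horizontal:
  assumes "common_end_form E W S t b" shows "\<exists>S. common_end_form E W S t b \<and> horizontal (S b)"
proof (cases "horizontal (S b)")
  case False
  then have "horizontal ((reflect \<circ> S) b)"
    using assms by (auto simp: common_end_form_def segment_rep_def)
  then show ?thesis using common_end_form_reflect[OF assms] by blast
qed (use assms in blast)

lemma drawable_insert_triangle:
  assumes "finite W" and form: "common_end_form E W S t b" and "E t b"
    and adj: "\<And>w. w \<in> W \<Longrightarrow> E v w \<longleftrightarrow> w = t \<or> w = b"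
  shows "drawable E (insert v W) v b"
proof -
  obtain S where form: "common_end_form E W S t b" and horizontal: "horizontal (S b)"
    using ex_common_end_form_horizontal[OF form] by blast
  let ?x = "xmax (S b)" and ?y = "ymin (S b)"
  obtain M where M: "\<forall>w\<in>W. xmax (S w) < M"
    using ex_strict_upper_bound[OF \<open>finite W\<close>, of "\<lambda>w. xmax (S w)"] by blast
  define S' where "S' = S(b := extend_right M (S b))"
  have right: "right_form E W S' b"
    unfolding S'_def
    by (rule right_form_extend_if_common_end_form[OF form \<open>E t b\<close> symp_E horizontal M])
  note form = form[unfolded common_end_form_def]
  note wf = segment_rep_wf[OF conjunct1[OF form]]
  have "?x < M" using form M by simp
  have "meets (Rect ?x M ?y ?y) (S' w) \<longleftrightarrow> w = t \<or> w = b" if "w \<in> W" for w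
  proof -
    consider "w = b" | "w = t" "w \<noteq> b" | "w \<in> W - {t, b}" using \<open>w \<in> W\<close> by blast
    then show ?thesis
      using form horizontal wf[OF that] \<open>?x < M\<close>
      by cases (auto simp: S'_def meets_def horizontal_def crosses_right_ray_def)
  qed
  then have "common_end_form E (insert v W) (S'(v := Rect ?x M ?y ?y)) v b"
    using common_end_form_insert_collinear[OF right, of ?x] adj \<open>?x < M\<close> by (simp add: S'_def)
  moreover
  obtain N where N: "\<forall>w\<in>W. N < ymin (S' w)"
    using ex_strict_lower_bound[OF \<open>finite W\<close>, of "\<lambda>w. ymin (S' w)"] by blast
  have "meets (Rect ?x ?x N ?y) (S' w) \<longleftrightarrow> w = t \<or> w = b" if "w \<in> W" for w
  proof -
    consider "w = b" | "w = t" "w \<noteq> b" | "w \<in> W - {t, b}" using \<open>w \<in> W\<close> by blast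
    then show ?thesis
      using form horizontal wf[OF that] \<open>?x < M\<close> N[rule_format, OF that]
      by cases (auto simp: S'_def meets_def horizontal_def crosses_down_ray_def)
  qed
  then have "corner_form E (insert v W) (S'(v := Rect ?x ?x N ?y)) v b"
    by (intro corner_form_insert_vertical[OF right _ _ N]) (use adj \<open>?x < M\<close> in \<open>auto simp: S'_def\<close>)
  moreover have "E v b" using form adj by blast
  ultimately show ?thesis by (auto simp: drawable_def)
qed

lemma ex_parallel_form_below:
  assumes form: "parallel_form E W S t b" and "\<not> E t b"
  shows "\<exists>S. parallel_form E W S t b \<and> ymin (S b) < ymin (S t)"
proof (cases "ymin (S b) < ymin (S t)")
  case False
  then have "ymin ((flip_vertically \<circ> S) b) < ymin ((flip_vertically \<circ> S) t)"
    using parallel_form_ymin_neq[OF assms] form by (auto simp: parallel_form_def horizontal_def)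
  then show ?thesis using parallel_form_flip_vertically[OF form] by blast
qed (use form in blast)

lemma drawable_insert_across:
  assumes "finite W" and form: "parallel_form E W S t b" and "\<not> E t b"
    and adj: "\<And>w. w \<in> W \<Longrightarrow> E v w \<longleftrightarrow> w = t \<or> w = b"
  shows "drawable E (insert v W) v b"
proof -
  obtain S where form: "parallel_form E W S t b" and below: "ymin (S b) < ymin (S t)"
    using ex_parallel_form_below[OF form \<open>\<not> E t b\<close>] by blast
  let ?x = "xmax (S b)"
  define S' where "S' = S(b := extend_right (?x + 1) (S b))"
  have right: "right_form E W S' b" unfolding S'_def
    by (rule right_form_extend_if_parallel_form[OF form \<open>\<not> E t b\<close> symp_E]) simp
  note xmax_less = parallel_form_xmax_less[OF form] and form = form[unfolded parallel_form_def]
  let ?A = "Rect ?x ?x (ymin (S b)) (ymin (S t))"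
  have "meets ?A (S w) \<longleftrightarrow> w = t \<or> w = b" if "w \<in> W" for w
    using form below xmax_less[OF that]
    by (cases "w = t"; cases "w = b") (auto simp: meets_def horizontal_def)
  then have "segment_rep E (insert v W) (S(v := ?A))"
    by (intro segment_rep_insert) (use form below adj symp_E fresh in \<open>auto simp: vertical_def\<close>)
  moreover have "\<not> crosses_right_ray ?x (ymin (S b)) (S w) \<and>
      \<not> crosses_down_ray ?x (ymin (S b)) (S w)"
    if "w \<in> W" "w \<noteq> b" for w
    using form below xmax_less[OF that(1) _ that(2)]
    by (cases "w = t") (simp_all add: crosses_right_ray_def crosses_down_ray_def horizontal_def)
  ultimately have "common_end_form E (insert v W) (S(v := ?A)) v b"
    using form fresh by (auto simp: common_end_form_def)
  moreover
  obtain N where N: "\<forall>w\<in>W. N < ymin (S' w)"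
    using ex_strict_lower_bound[OF \<open>finite W\<close>, of "\<lambda>w. ymin (S' w)"] by blast
  have "meets (Rect ?x ?x N (ymin (S t))) (S' w) \<longleftrightarrow> w = t \<or> w = b" if "w \<in> W" for w
    using form below xmax_less[OF that] N[rule_format, OF that]
    by (cases "w = t"; cases "w = b") (auto simp: meets_def horizontal_def S'_def)
  then have "corner_form E (insert v W) (S'(v := Rect ?x ?x N (ymin (S t)))) v b"
    by (intro corner_form_insert_vertical[OF right _ _ N]) (use adj below in \<open>auto simp: S'_def\<close>)
  moreover have "E v b" using form adj by blast
  ultimately show ?thesis by (auto simp: drawable_def)
qed

lemma drawable_insert:
  assumes "finite W" and drawable: "drawable E W t b"
    and nbrs: "\<And>w. w \<in> W \<Longrightarrow> E v w \<Longrightarrow> w = t \<or> w = b"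
  shows "drawable E (insert v W) v b"
proof -
  obtain S where right: "right_form E W S b" using right_form_if_drawable[OF drawable symp_E] ..
  consider (isolated) "\<not> E v t" "\<not> E v b" | (bottom) "\<not> E v t" "E v b"
    | (top) "E v t" "\<not> E v b" | (both) "E v t" "E v b" by blast
  then show ?thesis
  proof cases
    case isolated
    then show ?thesis using drawable_insert_isolated[OF right] nbrs by blast
  next
    case bottom
    then have "E v w \<longleftrightarrow> w = b" if "w \<in> W" for w using nbrs that by blast
    then show ?thesis by (rule drawable_insert_adjacent_bottom[OF \<open>finite W\<close> right])
  next
    case top
    then have "E v w \<longleftrightarrow> w = t" if "w \<in> W" for w using nbrs that by blast
    then show ?thesis
      using drawable drawable_insert_adjacent_top_if_corner_form
        drawable_insert_adjacent_top_if_parallel_form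
      by (metis drawable_def)
  next
    case both
    then have "E v w \<longleftrightarrow> w = t \<or> w = b" if "w \<in> W" for w using nbrs that by blast
    then show ?thesis
      using drawable drawable_insert_triangle[OF \<open>finite W\<close>]
        drawable_insert_across[OF \<open>finite W\<close>]
      by (metis drawable_def)
  qed
qed

end

section \<open>Sweeps\<close>

text \<open>The active vertices may be \<open>None\<close>, a dummy vertex adjacent to no other vertex.\<close>

definition unprocessed_nbrs :: "('a \<Rightarrow> 'a \<Rightarrow> bool) \<Rightarrow> 'a set \<Rightarrow> 'a option \<Rightarrow> 'a set" where
  "unprocessed_nbrs E U t = {u \<in> U. rel_option E t (Some u)}"

lemma unprocessed_nbrs_Some [simp]: "unprocessed_nbrs E U (Some x) = {u \<in> U. E x u}"
  by (simp add: unprocessed_nbrs_def)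

lemma unprocessed_nbrs_mono: "U' \<subseteq> U \<Longrightarrow> unprocessed_nbrs E U' t \<subseteq> unprocessed_nbrs E U t"
  by (auto simp: unprocessed_nbrs_def)

inductive sweepable :: "('a \<Rightarrow> 'a \<Rightarrow> bool) \<Rightarrow> 'a set \<Rightarrow> 'a option \<Rightarrow> 'a option \<Rightarrow> bool"
  for E where
  sweepable_empty: "sweepable E {} t b"
| sweepable_top: "v \<in> U \<Longrightarrow> unprocessed_nbrs E U t \<subseteq> {v} \<Longrightarrow>
    sweepable E (U - {v}) (Some v) b \<Longrightarrow> sweepable E U t b"
| sweepable_bottom: "v \<in> U \<Longrightarrow> unprocessed_nbrs E U b \<subseteq> {v} \<Longrightarrow>
    sweepable E (U - {v}) t (Some v) \<Longrightarrow> sweepable E U t b"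

lemma sweepable_commute: "sweepable E U t b \<Longrightarrow> sweepable E U b t"
  by (induction rule: sweepable.induct) (auto intro: sweepable.intros)

definition partial_drawing ::
    "('a \<Rightarrow> 'a \<Rightarrow> bool) \<Rightarrow> 'a option set \<Rightarrow> 'a set \<Rightarrow> 'a option \<Rightarrow> 'a option \<Rightarrow> bool" where
  "partial_drawing E W U t b \<longleftrightarrow> finite W \<and> W \<inter> Some ` U = {} \<and> drawable (rel_option E) W t b \<and>
     (\<forall>w\<in>W. w \<noteq> t \<longrightarrow> w \<noteq> b \<longrightarrow> unprocessed_nbrs E U w = {})"

lemma partial_drawing_commute:
  "symp E \<Longrightarrow> partial_drawing E W U t b \<Longrightarrow> partial_drawing E W U b t"
  using drawable_commute[OF option.rel_symp] by (auto simp: partial_drawing_def)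

lemma partial_drawing_insert:
  assumes "symp E" and partial: "partial_drawing E W U t b"
    and v: "v \<in> U" "unprocessed_nbrs E U t \<subseteq> {v}"
  shows "partial_drawing E (insert (Some v) W) (U - {v}) (Some v) b"
proof -
  have symp: "symp (rel_option E)" using \<open>symp E\<close> by (rule option.rel_symp)
  have "w = t \<or> w = b" if "w \<in> W" "rel_option E (Some v) w" for w
    using partial v(1) that sympD[OF symp that(2)]
    by (auto simp: partial_drawing_def unprocessed_nbrs_def)
  then have "drawable (rel_option E) (insert (Some v) W) (Some v) b"
    using partial v(1) by (intro drawable_insert[OF symp]) (auto simp: partial_drawing_def)
  moreover have "unprocessed_nbrs E (U - {v}) w = {}" if "w \<in> W" "w \<noteq> b" for w
    using partial v(2) that by (cases "w = t") (auto simp: partial_drawing_def unprocessed_nbrs_def)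
  ultimately show ?thesis using partial v(1) by (auto simp: partial_drawing_def)
qed

lemma segment_rep_if_sweepable:
  assumes "sweepable E U t b" "symp E" "partial_drawing E W U t b"
  shows "\<exists>S. segment_rep (rel_option E) (W \<union> Some ` U) S"
  using assms
proof (induction arbitrary: W rule: sweepable.induct)
  case (sweepable_empty t b)
  then show ?case by (auto simp: partial_drawing_def dest: segment_rep_if_drawable)
next
  case (sweepable_top v U t b)
  have "insert (Some v) W \<union> Some ` (U - {v}) = W \<union> Some ` U" using sweepable_top.hyps(1) by auto
  then show ?case
    using sweepable_top partial_drawing_insert[of E W U t b v] by metis
next
  case (sweepable_bottom v U b t)
  have "insert (Some v) W \<union> Some ` (U - {v}) = W \<union> Some ` U" using sweepable_bottom.hyps(1) by auto
  then show ?case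
    using sweepable_bottom partial_drawing_insert[of E W U b t v] partial_drawing_commute by metis
qed

lemma segment_rep_if_sweepable_from:
  assumes "sweepable E (V - {s}) (Some s) None" "s \<in> V" "symp E"
  shows "\<exists>S. segment_rep (rel_option E) (Some ` V) S"
proof -
  let ?S = "case_option (Rect 0 0 0 0) (\<lambda>_. Rect 0 0 1 1)"
  have "parallel_form (rel_option E) {Some s, None} ?S (Some s) None"
    by (auto simp: parallel_form_def segment_rep_def horizontal_def meets_def)
  then have "partial_drawing E {Some s, None} (V - {s}) (Some s) None"
    by (auto simp: partial_drawing_def drawable_def)
  from segment_rep_if_sweepable[OF assms(1,3) this] show ?thesis
    using segment_rep_mono[of "rel_option E" _ _ "Some ` V"] assms(2) by blast
qed

definition rect_points :: "rect \<Rightarrow> complex set" where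
  "rect_points A = {z. xmin A \<le> Re z \<and> Re z \<le> xmax A \<and> ymin A \<le> Im z \<and> Im z \<le> ymax A}"

lemma horizontal_segment_rect_points: "horizontal A \<Longrightarrow> horizontal_segment (rect_points A)"
  unfolding horizontal_segment_def
  by (intro exI[of _ "Complex (xmin A) (ymin A)"] exI[of _ "Complex (xmax A) (ymin A)"])
     (auto simp: horizontal_def rect_points_def closed_segment_same_Im closed_segment_eq_real_ivl)

lemma vertical_segment_rect_points: "vertical A \<Longrightarrow> vertical_segment (rect_points A)"
  unfolding vertical_segment_def
  by (intro exI[of _ "Complex (xmin A) (ymin A)"] exI[of _ "Complex (xmin A) (ymax A)"])
     (auto simp: vertical_def rect_points_def closed_segment_same_Re closed_segment_eq_real_ivl)

lemma rect_points_meet_iff: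
  assumes "xmin A \<le> xmax A" "ymin A \<le> ymax A" "xmin B \<le> xmax B" "ymin B \<le> ymax B"
  shows "rect_points A \<inter> rect_points B \<noteq> {} \<longleftrightarrow> meets A B"
proof
  assume "meets A B"
  then have
    "Complex (max (xmin A) (xmin B)) (max (ymin A) (ymin B)) \<in> rect_points A \<inter> rect_points B"
    using assms by (auto simp: meets_def rect_points_def)
  then show "rect_points A \<inter> rect_points B \<noteq> {}" by blast
qed (force simp: meets_def rect_points_def)

lemma B0_VPG_if_segment_rep:
  assumes rep: "segment_rep E (f ` pverts G) S" and "inj_on f (pverts G)"
    and adj: "\<And>x y. x \<in> pverts G \<Longrightarrow> y \<in> pverts G \<Longrightarrow> E (f x) (f y) \<longleftrightarrow> (x, y) \<in> parcs G"
  shows "B0_VPG G"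
  unfolding B0_VPG_def
proof (intro exI[of _ "rect_points \<circ> S \<circ> f"] conjI ballI impI)
  fix x assume "x \<in> pverts G"
  then show "horizontal_segment ((rect_points \<circ> S \<circ> f) x) \<or>
      vertical_segment ((rect_points \<circ> S \<circ> f) x)"
    using rep horizontal_segment_rect_points vertical_segment_rect_points
    by (auto simp: segment_rep_def)
next
  fix x y assume xy: "x \<in> pverts G" "y \<in> pverts G" "x \<noteq> y"
  then have "f x \<noteq> f y" using \<open>inj_on f (pverts G)\<close> by (simp add: inj_on_eq_iff)
  then have "(x, y) \<in> parcs G \<longleftrightarrow> meets (S (f x)) (S (f y))"
    using adj xy adjacent_iff_meets[OF rep, of "f x" "f y"] by simp
  then show "(x, y) \<in> parcs G \<longleftrightarrow> (rect_points \<circ> S \<circ> f) x \<inter> (rect_points \<circ> S \<circ> f) y \<noteq> {}"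
    using xy segment_rep_wf[OF rep] by (simp add: rect_points_meet_iff)
qed

section \<open>Connectivity inside vertex sets\<close>

definition conn :: "('a \<Rightarrow> 'a \<Rightarrow> bool) \<Rightarrow> 'a set \<Rightarrow> 'a \<Rightarrow> 'a \<Rightarrow> bool" where
  "conn E A x y \<longleftrightarrow> (x, y) \<in> rtrancl_on A {(u, v). E u v}"

definition component :: "('a \<Rightarrow> 'a \<Rightarrow> bool) \<Rightarrow> 'a set \<Rightarrow> 'a \<Rightarrow> 'a set" where
  "component E A x = {y. conn E A x y}"

definition connected_set :: "('a \<Rightarrow> 'a \<Rightarrow> bool) \<Rightarrow> 'a set \<Rightarrow> bool" where
  "connected_set E X \<longleftrightarrow> X \<noteq> {} \<and> (\<forall>x\<in>X. \<forall>y\<in>X. conn E X x y)"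

definition touches :: "('a \<Rightarrow> 'a \<Rightarrow> bool) \<Rightarrow> 'a set \<Rightarrow> 'a set \<Rightarrow> bool" where
  "touches E X Y \<longleftrightarrow> (\<exists>x\<in>X. \<exists>y\<in>Y. E x y)"

definition path_in :: "('a \<Rightarrow> 'a \<Rightarrow> bool) \<Rightarrow> 'a set \<Rightarrow> 'a \<Rightarrow> 'a list \<Rightarrow> 'a \<Rightarrow> bool" where
  "path_in E A x p y \<longleftrightarrow>
     p \<noteq> [] \<and> hd p = x \<and> last p = y \<and> distinct p \<and> successively E p \<and> set p \<subseteq> A"

lemma conn_refl: "x \<in> A \<Longrightarrow> conn E A x x"
  by (simp add: conn_def)

lemma conn_in: "conn E A x y \<Longrightarrow> x \<in> A" "conn E A x y \<Longrightarrow> y \<in> A"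
  by (auto simp: conn_def dest: in_rtrancl_on_in_F)

lemma conn_step: "conn E A x y \<Longrightarrow> E y z \<Longrightarrow> z \<in> A \<Longrightarrow> conn E A x z"
  unfolding conn_def by (auto intro: rtrancl_on_into_rtrancl_on)

lemma conn_edge: "x \<in> A \<Longrightarrow> y \<in> A \<Longrightarrow> E x y \<Longrightarrow> conn E A x y"
  by (rule conn_step[OF conn_refl])

lemma conn_trans: "conn E A x y \<Longrightarrow> conn E A y z \<Longrightarrow> conn E A x z"
  unfolding conn_def by (rule rtrancl_on_trans)

lemma conn_induct [consumes 1, case_names refl step]:
  assumes "conn E A x y" "x \<in> A \<Longrightarrow> P x"
    "\<And>y z. conn E A x y \<Longrightarrow> P y \<Longrightarrow> E y z \<Longrightarrow> z \<in> A \<Longrightarrow> P z"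
  shows "P y"
proof -
  have "(x, y) \<in> rtrancl_on A {(u, v). E u v}" using assms(1) by (simp add: conn_def)
  then show ?thesis
    by (induction rule: rtrancl_on_induct) (use assms(2,3) in \<open>simp_all add: conn_def\<close>)
qed

lemma conn_mono: "conn E A x y \<Longrightarrow> A \<subseteq> B \<Longrightarrow> conn E B x y"
  unfolding conn_def by (rule rtrancl_on_mono[OF subset_refl])

lemma conn_sym: "symp E \<Longrightarrow> conn E A x y \<Longrightarrow> conn E A y x"
  using rtrancl_on_sym[of "{(u, v). E u v}" A] unfolding conn_def sym_def symp_def by blast

lemma component_subset: "component E A x \<subseteq> A"
  by (auto simp: component_def dest: conn_in)

lemma in_component_self: "x \<in> A \<Longrightarrow> x \<in> component E A x"
  by (simp add: component_def conn_refl)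

lemma conn_in_component: "conn E A x y \<Longrightarrow> conn E (component E A x) x y"
proof (induction rule: conn_induct)
  case refl
  then show ?case by (intro conn_refl in_component_self)
next
  case (step y z)
  then show ?case using conn_step[OF step.hyps] by (auto simp: component_def intro: conn_step)
qed

lemma connected_set_component:
  assumes "symp E" "x \<in> A" shows "connected_set E (component E A x)"
proof -
  have "conn E (component E A x) x y" if "y \<in> component E A x" for y
    using that by (intro conn_in_component) (simp add: component_def)
  then show ?thesis
    using in_component_self[OF assms(2)] conn_trans conn_sym[OF assms(1)]
    unfolding connected_set_def by (metis empty_iff)
qed

lemma conn_if_connected_set:
  "connected_set E X \<Longrightarrow> X \<subseteq> A \<Longrightarrow> x \<in> X \<Longrightarrow> y \<in> X \<Longrightarrow> conn E A x y"
  unfolding connected_set_def by (blast intro: conn_mono)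

lemma conn_last_edge:
  assumes "conn E A s t" "s \<noteq> t" shows "\<exists>y. conn E (A - {t}) s y \<and> E y t"
proof -
  have "conn E (A - {t}) s x \<or> (\<exists>y. conn E (A - {t}) s y \<and> E y t)" if "conn E A s x" for x
    using that
  proof (induction rule: conn_induct)
    case refl
    then show ?case using assms(2) by (auto intro: conn_refl)
  next
    case (step y z)
    then show ?case using conn_step[of E "A - {t}" s y z] by (cases "z = t") auto
  qed
  from this[OF assms(1)] show ?thesis using conn_in(2)[of E "A - {t}" s t] by auto
qed

lemma connected_set_singleton: "connected_set E {x}"
  by (simp add: connected_set_def conn_refl)

lemma connected_set_insert:
  assumes "symp E" "connected_set E X" "y \<in> X" "E x y" shows "connected_set E (insert x X)"
proof -
  have old: "conn E (insert x X) y a" if "a \<in> X" for a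
    using conn_if_connected_set[OF assms(2) subset_insertI] assms(3) that by blast
  moreover have "conn E (insert x X) x y" using assms(3,4) by (intro conn_edge) auto
  ultimately have "conn E (insert x X) y a" if "a \<in> insert x X" for a
    using that conn_sym[OF assms(1)] by blast
  then show ?thesis
    using conn_trans conn_sym[OF assms(1)] unfolding connected_set_def by (metis insert_not_empty)
qed

lemma connected_set_pair: "symp E \<Longrightarrow> E x y \<Longrightarrow> connected_set E {x, y}"
  using connected_set_insert[OF _ connected_set_singleton] by fast

lemma connected_set_if_successively:
  assumes "symp E" "successively E xs" "xs \<noteq> []" shows "connected_set E (set xs)"
  using assms(2,3)
proof (induction xs rule: induct_list012)
  case (3 x y zs)
  then have "connected_set E (insert x (set (y # zs)))"
    by (intro connected_set_insert[OF assms(1), where y = y]) simp_all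
  then show ?case by simp
qed (simp_all add: connected_set_singleton)

lemma ex_path_in_if_conn:
  assumes "conn E A x y" shows "\<exists>p. path_in E A x p y"
  using assms
proof (induction rule: conn_induct)
  case refl
  then show ?case by (intro exI[of _ "[x]"]) (simp add: path_in_def)
next
  case (step y z)
  then obtain p where p: "path_in E A x p y" by blast
  show ?case
  proof (cases "z \<in> set p")
    case True
    then obtain ps qs where "p = ps @ z # qs" by (meson split_list)
    moreover from this have "hd (ps @ [z]) = x" using p by (cases ps) (auto simp: path_in_def)
    ultimately have "path_in E A x (ps @ [z]) z"
      using p by (auto simp: path_in_def successively_append_iff)
    then show ?thesis ..
  next
    case False
    then have "path_in E A x (p @ [z]) z"
      using p step by (auto simp: path_in_def successively_append_iff)
    then show ?thesis ..
  qed
qed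

lemma ex_path_in_if_connected_set:
  "connected_set E A \<Longrightarrow> x \<in> A \<Longrightarrow> y \<in> A \<Longrightarrow> \<exists>p. path_in E A x p y"
  by (simp add: connected_set_def ex_path_in_if_conn)

lemma touches_singleton [simp]:
  "touches E {x} Y \<longleftrightarrow> (\<exists>y\<in>Y. E x y)" "touches E X {y} \<longleftrightarrow> (\<exists>x\<in>X. E x y)"
  by (auto simp: touches_def)

section \<open>Admissible vertices\<close>

definition nbhd :: "('a \<Rightarrow> 'a \<Rightarrow> bool) \<Rightarrow> 'a \<Rightarrow> 'a set" where
  "nbhd E z = insert z {x. E z x}"

definition conn_avoiding :: "('a \<Rightarrow> 'a \<Rightarrow> bool) \<Rightarrow> 'a set \<Rightarrow> 'a \<Rightarrow> 'a \<Rightarrow> 'a \<Rightarrow> bool" where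
  "conn_avoiding E V x y z \<longleftrightarrow> conn E (V - nbhd E z) x y"

definition has_AT :: "('a \<Rightarrow> 'a \<Rightarrow> bool) \<Rightarrow> 'a set \<Rightarrow> bool" where
  "has_AT E V \<longleftrightarrow> (\<exists>a\<in>V. \<exists>b\<in>V. \<exists>c\<in>V.
     conn_avoiding E V a b c \<and> conn_avoiding E V b c a \<and> conn_avoiding E V a c b)"

definition admissible :: "('a \<Rightarrow> 'a \<Rightarrow> bool) \<Rightarrow> 'a set \<Rightarrow> 'a \<Rightarrow> bool" where
  "admissible E V s \<longleftrightarrow> s \<in> V \<and>
     \<not> (\<exists>y\<in>V. \<exists>z\<in>V. conn_avoiding E V s y z \<and> conn_avoiding E V s z y)"

definition boundary :: "('a \<Rightarrow> 'a \<Rightarrow> bool) \<Rightarrow> 'a set \<Rightarrow> 'a set \<Rightarrow> 'a set" where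
  "boundary E V K = {v \<in> V - K. \<exists>k\<in>K. E k v}"

definition remote_component :: "('a \<Rightarrow> 'a \<Rightarrow> bool) \<Rightarrow> 'a set \<Rightarrow> 'a \<Rightarrow> 'a set \<Rightarrow> bool" where
  "remote_component E V x K \<longleftrightarrow>
     x \<in> V \<and> (\<exists>w\<in>V - nbhd E x. K = component E (V - nbhd E x) w)"

lemma nbhd_commute: "symp E \<Longrightarrow> y \<in> nbhd E x \<longleftrightarrow> x \<in> nbhd E y"
  unfolding nbhd_def by (blast dest: sympD)

lemma conn_avoiding_in:
  assumes "conn_avoiding E V x y z"
  shows "x \<in> V" "y \<in> V" "x \<notin> nbhd E z" "y \<notin> nbhd E z"
  using conn_in[OF assms[unfolded conn_avoiding_def]] by blast+

lemma conn_avoiding_mono: "conn_avoiding E V x y z \<Longrightarrow> V \<subseteq> V' \<Longrightarrow> conn_avoiding E V' x y z"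
  unfolding conn_avoiding_def by (erule conn_mono) auto

lemma has_AT_mono: "has_AT E V \<Longrightarrow> V \<subseteq> V' \<Longrightarrow> has_AT E V'"
  unfolding has_AT_def by (meson conn_avoiding_mono subsetD)

lemma has_ATI:
  assumes "conn_avoiding E V a b c" "conn_avoiding E V b c a" "conn_avoiding E V a c b"
  shows "has_AT E V"
  using assms conn_avoiding_in(1)[OF assms(1)] conn_avoiding_in[OF assms(2)]
  unfolding has_AT_def by blast

lemma ex_largest_remote_component:
  assumes "finite V" "x \<in> V" "\<not> V \<subseteq> nbhd E x"
  obtains x K where "remote_component E V x K"
    "\<And>x' K'. remote_component E V x' K' \<Longrightarrow> card K' \<le> card K"
proof -
  have bounded: "card K \<le> card V" if "remote_component E V x K" for x K
  proof (rule card_mono[OF \<open>finite V\<close>])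
    show "K \<subseteq> V" using that component_subset by (fastforce simp: remote_component_def)
  qed
  obtain K where "remote_component E V x K"
    using assms(2,3) by (auto simp: remote_component_def)
  then obtain K where "\<exists>x. remote_component E V x K"
    and "\<forall>K'. (\<exists>x. remote_component E V x K') \<longrightarrow> card K' \<le> card K"
    using ex_has_greatest_nat[of "\<lambda>K. \<exists>x. remote_component E V x K" K card "Suc (card V)"] bounded
    by (auto simp: less_Suc_eq_le)
  then show thesis using that by blast
qed

text \<open>Otherwise adding a missed boundary vertex to \<open>K\<close> would give a larger connected set that is
  remote from \<open>a\<close>.\<close>

lemma boundary_subset_nbhd_if_largest:
  assumes "finite V" "symp E" and remote: "remote_component E V x K"
    and largest: "\<And>x' K'. remote_component E V x' K' \<Longrightarrow> card K' \<le> card K"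
    and a: "a \<in> V - K - boundary E V K"
  shows "boundary E V K \<subseteq> nbhd E a"
proof (rule subsetI, rule ccontr)
  fix n assume n: "n \<in> boundary E V K" "n \<notin> nbhd E a"
  then obtain k where k: "k \<in> K" "E k n" "n \<in> V - K" by (auto simp: boundary_def)
  have K: "connected_set E K" "K \<subseteq> V"
    using remote connected_set_component[OF \<open>symp E\<close>] component_subset[of E "V - nbhd E x"]
    by (auto simp: remote_component_def)
  have away: "K \<subseteq> V - nbhd E a"
    using K(2) a sympD[OF \<open>symp E\<close>] unfolding nbhd_def boundary_def by blast
  let ?K' = "component E (V - nbhd E a) k"
  have "K \<subseteq> ?K'"
    using conn_if_connected_set[OF K(1) away k(1)] by (auto simp: component_def)
  moreover have "n \<in> ?K'"
    using k(1,2,3) n(2) away by (auto simp: component_def intro: conn_step conn_refl)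
  moreover have "finite ?K'"
    using component_subset[of E "V - nbhd E a" k] \<open>finite V\<close> by (meson finite_Diff finite_subset)
  ultimately have "card K < card ?K'" using k(3) by (intro psubset_card_mono) auto
  moreover have "remote_component E V a ?K'"
    using a k(1) away by (auto simp: remote_component_def)
  ultimately show False using largest by fastforce
qed

lemma admissible_if_admissible_in_remainder:
  assumes "symp E" "\<not> has_AT E V" and K: "connected_set E K" "K \<subseteq> V"
  defines "A \<equiv> V - K - boundary E V K"
  assumes dominated: "\<And>a. a \<in> A \<Longrightarrow> boundary E V K \<subseteq> nbhd E a" and s: "admissible E A s"
  shows "admissible E V s"
proof -
  have s_in: "s \<in> A" using s by (simp add: admissible_def)
  have nonadj: "\<not> E a k" "\<not> E k a" if "a \<in> A" "k \<in> K" for a k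
    using that sympD[OF \<open>symp E\<close>] unfolding A_def boundary_def by blast+
  have stay: "conn_avoiding E A s y z" if "z \<in> A" "conn_avoiding E V s y z" for y z
    using that(2) unfolding conn_avoiding_def
  proof (induction rule: conn_induct)
    case refl
    then show ?case using s_in by (auto intro: conn_refl)
  next
    case (step u v)
    have "u \<in> A" using conn_in(2)[OF step.IH] by blast
    then have "v \<in> A" using step dominated[OF that(1)] nonadj unfolding A_def by blast
    then show ?case using step by (auto intro: conn_step)
  qed
  have False if mutual: "conn_avoiding E V s y z" "conn_avoiding E V s z y" for y z
  proof -
    have "\<not> (z \<in> A \<or> y \<in> A)"
    proof
      assume "z \<in> A \<or> y \<in> A"
      then have "z \<in> A" "y \<in> A" using mutual stay conn_avoiding_in(2) by metis+
      then show False using mutual stay s unfolding admissible_def by blast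
    qed
    moreover have "y \<notin> nbhd E s" "z \<notin> nbhd E s"
      using mutual conn_avoiding_in(3) nbhd_commute[OF \<open>symp E\<close>] by metis+
    ultimately have yz: "y \<in> K" "z \<in> K"
      using dominated[OF s_in] mutual[THEN conn_avoiding_in(2)] unfolding A_def by blast+
    have "K \<subseteq> V - nbhd E s" using K(2) nonadj s_in unfolding nbhd_def A_def by blast
    then have "conn_avoiding E V y z s"
      using conn_if_connected_set[OF K(1)] yz unfolding conn_avoiding_def by blast
    then show False using mutual \<open>\<not> has_AT E V\<close> has_ATI by metis
  qed
  then show ?thesis using s_in unfolding admissible_def A_def by blast
qed

lemma ex_admissible:
  assumes "symp E" "finite V" "V \<noteq> {}" "\<not> has_AT E V"
  shows "\<exists>s. admissible E V s"
  using assms(2-4)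
proof (induction V rule: finite_psubset_induct)
  case (psubset V)
  show ?case
  proof (cases "\<forall>x\<in>V. V \<subseteq> nbhd E x")
    case True
    obtain s where "s \<in> V" using psubset.prems by blast
    then have "admissible E V s"
      using True conn_avoiding_in(3)[of E V s] unfolding admissible_def by blast
    then show ?thesis ..
  next
    case False
    then obtain x K where remote: "remote_component E V x K"
      and largest: "\<And>x' K'. remote_component E V x' K' \<Longrightarrow> card K' \<le> card K"
      using ex_largest_remote_component psubset.hyps by metis
    obtain w where x: "x \<in> V" and w: "w \<in> V - nbhd E x" and K: "K = component E (V - nbhd E x) w"
      using remote by (auto simp: remote_component_def)
    have K_sub: "K \<subseteq> V - nbhd E x" unfolding K by (rule component_subset)
    have K_conn: "connected_set E K" unfolding K by (rule connected_set_component[OF assms(1) w])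
    define A where "A = V - K - boundary E V K"
    have "w \<in> K" unfolding K by (rule in_component_self[OF w])
    then have "A \<subset> V" using w unfolding A_def by blast
    have "x \<in> A" using x K_sub sympD[OF assms(1)] unfolding A_def boundary_def nbhd_def by blast
    then obtain s where "admissible E A s"
      using psubset.IH[OF \<open>A \<subset> V\<close>] psubset.prems has_AT_mono[of E A V] \<open>A \<subset> V\<close> by blast
    moreover have "boundary E V K \<subseteq> nbhd E a" if "a \<in> A" for a
      using that largest unfolding A_def
      by (intro boundary_subset_nbhd_if_largest[OF psubset.hyps assms(1) remote]) blast+
    ultimately have "admissible E V s"
      using admissible_if_admissible_in_remainder[OF assms(1) psubset.prems(2) K_conn] K_sub
      unfolding A_def by blast
    then show ?thesis ..
  qed
qed

section \<open>Existence of sweeps\<close>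

definition K23_model :: "('a \<Rightarrow> 'a \<Rightarrow> bool) \<Rightarrow> 'a set \<Rightarrow> 'a set \<Rightarrow> 'a set \<Rightarrow> 'a set \<Rightarrow> 'a set \<Rightarrow> bool" where
  "K23_model E X Y A B C \<longleftrightarrow> (\<forall>S\<in>{X, Y, A, B, C}. connected_set E S) \<and>
     sorted_wrt disjnt [X, Y, A, B, C] \<and> (\<forall>S\<in>{A, B, C}. touches E X S \<and> touches E Y S)"

definition K23_minor_free :: "('a \<Rightarrow> 'a \<Rightarrow> bool) \<Rightarrow> bool" where
  "K23_minor_free E \<longleftrightarrow> (\<nexists>X Y A B C. K23_model E X Y A B C)"

definition K4_free :: "('a \<Rightarrow> 'a \<Rightarrow> bool) \<Rightarrow> bool" where
  "K4_free E \<longleftrightarrow> (\<nexists>a b c d. E a b \<and> E a c \<and> E a d \<and> E b c \<and> E b d \<and> E c d)"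

definition leaf_in :: "('a \<Rightarrow> 'a \<Rightarrow> bool) \<Rightarrow> 'a set \<Rightarrow> 'a \<Rightarrow> bool" where
  "leaf_in E X x \<longleftrightarrow> (\<forall>u\<in>X. \<forall>v\<in>X. E x u \<longrightarrow> E x v \<longrightarrow> u = v)"

fun forward_ordering :: "('a \<Rightarrow> 'a \<Rightarrow> bool) \<Rightarrow> 'a list \<Rightarrow> bool" where
  "forward_ordering E [] \<longleftrightarrow> True"
| "forward_ordering E (r # rs) \<longleftrightarrow> (\<forall>u\<in>set rs. E r u \<longrightarrow> u = hd rs) \<and> forward_ordering E rs"

lemma neq_last_if_in_butlast: "distinct xs \<Longrightarrow> x \<in> set (butlast xs) \<Longrightarrow> x \<noteq> last xs"
  by (induction xs) (auto split: if_splits)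

lemma forward_ordering_snoc:
  assumes "forward_ordering E rs" "\<And>u. u \<in> set (butlast rs) \<Longrightarrow> \<not> E u p"
  shows "forward_ordering E (rs @ [p])"
  using assms
proof (induction rs)
  case (Cons r rs)
  then show ?case by (cases rs) auto
qed simp

lemma sweepable_if_forward_ordering:
  assumes "forward_ordering E rs" "rs \<noteq> []" "distinct rs" "set rs \<subseteq> U"
    and "unprocessed_nbrs E U t \<subseteq> {hd rs}"
    and "\<And>r. r \<in> set (butlast rs) \<Longrightarrow> unprocessed_nbrs E U (Some r) \<subseteq> set rs"
    and "sweepable E (U - set rs) (Some (last rs)) b"
  shows "sweepable E U t b"
  using assms
proof (induction rs arbitrary: U t)
  case (Cons r rs)
  show ?case
  proof (rule sweepable_top)
    show "r \<in> U" "unprocessed_nbrs E U t \<subseteq> {r}" using Cons.prems by simp_all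
    show "sweepable E (U - {r}) (Some r) b"
    proof (cases "rs = []")
      case True
      then show ?thesis using Cons.prems by simp
    next
      case False
      have vertices_eq: "U - {r} - set rs = U - set (r # rs)" by auto
      show ?thesis
      proof (rule Cons.IH[OF _ False])
        show "unprocessed_nbrs E (U - {r}) (Some r) \<subseteq> {hd rs}"
          using Cons.prems(1,6) False by fastforce
        show "unprocessed_nbrs E (U - {r}) (Some r') \<subseteq> set rs" if "r' \<in> set (butlast rs)" for r'
          using Cons.prems(6)[of r'] that False by auto
        show "sweepable E (U - {r} - set rs) (Some (last rs)) b"
          unfolding vertices_eq using Cons.prems(7) False by simp
      qed (use Cons.prems in auto)
    qed
  qed
qed simp

locale K23_K4_free =
  fixes E :: "'a \<Rightarrow> 'a \<Rightarrow> bool"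
  assumes symp: "symp E" and irrefl: "\<not> E x x"
    and K23_minor_free: "K23_minor_free E" and K4_free: "K4_free E"
begin

lemma sym: "E x y \<Longrightarrow> E y x"
  using symp by (rule sympD)

lemmas connected_set_intros =
  connected_set_singleton connected_set_pair[OF symp] connected_set_insert[OF symp]

lemma not_K23_model: "\<not> K23_model E X Y A B C"
  using K23_minor_free unfolding K23_minor_free_def by blast

lemma not_K4: "\<not> (E a b \<and> E a c \<and> E a d \<and> E b c \<and> E b d \<and> E c d)"
  using K4_free unfolding K4_free_def by blast

lemma common_nbr_unique:
  assumes "t \<noteq> b" "connected_set E S" "touches E {t} S" "touches E {b} S"
    and "S \<inter> {t, b, c, c'} = {}" "E t c" "E b c" "E t c'" "E b c'"
  shows "c = c'"
proof (rule ccontr)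
  assume "c \<noteq> c'"
  then have "K23_model E {t} {b} {c} {c'} S"
    using assms irrefl by (auto simp: K23_model_def disjnt_def connected_set_singleton)
  then show False using not_K23_model by blast
qed

lemma common_nbr_separates:
  assumes "t \<noteq> b" "connected_set E S" "touches E {t} S" "touches E {b} S"
    and "S \<inter> {t, b, c, x, y} = {}" "E t c" "E b c" "E t x" "E b y"
    and "x \<noteq> c" "y \<noteq> c" "x \<noteq> b" "y \<noteq> t"
  shows "\<not> E x y"
proof
  assume "E x y"
  then have "K23_model E {t} {b} {c} {x, y} S"
    using assms irrefl by (auto simp: K23_model_def disjnt_def intro: connected_set_intros)
  then show False using not_K23_model by blast
qed

lemma not_K23_subgraph:
  assumes "distinct [x1, x2, y1, y2, y3]" "\<And>y. y \<in> {y1, y2, y3} \<Longrightarrow> E x1 y \<and> E x2 y"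
  shows False
proof -
  have "K23_model E {x1} {x2} {y1} {y2} {y3}"
    using assms by (auto simp: K23_model_def connected_set_singleton)
  then show False using not_K23_model by blast
qed

lemma ex_nonadjacent_private_nbrs:
  assumes tb: "t \<noteq> b" "t \<notin> U" "b \<notin> U"
    and S: "connected_set E S" "S \<inter> insert t (insert b U) = {}" "touches E {t} S" "touches E {b} S"
    and x: "x1 \<in> U" "x2 \<in> U" "x1 \<noteq> x2" "E t x1" "E t x2"
    and y: "y1 \<in> U" "y2 \<in> U" "y1 \<noteq> y2" "E b y1" "E b y2"
  shows "\<exists>x\<in>U. \<exists>y\<in>U. E t x \<and> \<not> E b x \<and> E b y \<and> \<not> E t y \<and> \<not> E x y"
proof (rule ccontr)
  assume "\<not> ?thesis"
  then have adjacent: "E x y"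
    if "x \<in> U" "y \<in> U" "E t x" "\<not> E b x" "E b y" "\<not> E t y" for x y
    using that by blast
  show False
  proof (cases "\<exists>c\<in>U. E t c \<and> E b c")
    case True
    then obtain c where c: "c \<in> U" "E t c" "E b c" by blast
    obtain x y where xy: "x \<in> U" "E t x" "x \<noteq> c" "y \<in> U" "E b y" "y \<noteq> c" using x y by metis
    have "\<not> E b x" "\<not> E t y" using common_nbr_unique[OF tb(1) S(1,3,4), of c] c xy S(2) by blast+
    then have "E x y" using adjacent xy by blast
    moreover have "\<not> E x y"
      by (rule common_nbr_separates[OF tb(1) S(1,3,4) _ c(2,3)]) (use xy c S(2) tb in auto)
    ultimately show False by blast
  next
    case False
    then have "E x1 y1" "E x1 y2" "E x2 y1" "E x2 y2" using adjacent x y by blast+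
    moreover have "distinct [x1, x2, y1, y2, t]" using False x y tb by auto
    ultimately show False using x(4,5) by (auto intro: not_K23_subgraph[of x1 x2 y1 y2 t] sym)
  qed
qed

definition one_active :: "'a set \<Rightarrow> 'a \<Rightarrow> bool" where
  "one_active U b \<longleftrightarrow>
     finite U \<and> b \<notin> U \<and> \<not> has_AT E (insert b U) \<and> admissible E (insert b U) b"

text \<open>Here \<open>W\<close> consists of the last single active vertex \<open>s\<close> and the vertices processed since then.\<close>

definition two_active :: "'a set \<Rightarrow> 'a set \<Rightarrow> 'a \<Rightarrow> 'a \<Rightarrow> 'a \<Rightarrow> bool" where
  "two_active W U s t b \<longleftrightarrow> finite U \<and> W \<inter> U = {} \<and> \<not> has_AT E (W \<union> U) \<and> admissible E (W \<union> U) s \<and>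
     s \<in> W - {t, b} \<and> t \<noteq> b \<and> conn E (W - {b}) s t \<and> conn E (W - {t}) s b \<and>
     (\<forall>w\<in>W. \<forall>u\<in>U. E w u \<longrightarrow> w = t \<or> w = b)"

lemma one_active_advance:
  assumes "one_active U b" and m: "m \<in> U" "E b m" "\<And>u. u \<in> U \<Longrightarrow> E b u \<Longrightarrow> u = m"
  shows "one_active (U - {m}) m"
proof -
  note state = assms(1)[unfolded one_active_def]
  have vertices_eq: "insert m (U - {m}) = U" using m(1) by auto
  have "conn_avoiding E (insert b U) b y z" if "conn_avoiding E U m y z" "z \<in> U" for y z
  proof -
    have "m \<notin> nbhd E z" using conn_avoiding_in(3)[OF that(1)] .
    then have "b \<notin> nbhd E z" using that(2) m(3) state sym unfolding nbhd_def by blast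
    then have "conn E (insert b U - nbhd E z) b m"
      using m(1,2) \<open>m \<notin> nbhd E z\<close> by (intro conn_edge) auto
    moreover have "conn E (insert b U - nbhd E z) m y"
      using that(1) unfolding conn_avoiding_def by (auto elim!: conn_mono)
    ultimately show ?thesis unfolding conn_avoiding_def by (rule conn_trans)
  qed
  then have "admissible E U m" using state m(1) unfolding admissible_def by blast
  moreover have "\<not> has_AT E U" using state has_AT_mono[of E U "insert b U"] by blast
  ultimately show ?thesis using state unfolding one_active_def vertices_eq by blast
qed

lemma two_active_commute: "two_active W U s t b \<Longrightarrow> two_active W U s b t"
  unfolding two_active_def by auto

lemma two_active_in:
  assumes "two_active W U s t b" shows "t \<in> W" "b \<in> W"
  using assms conn_in(2) unfolding two_active_def by fast+

lemma two_active_advance: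
  assumes "two_active W U s t b" and v: "v \<in> U" "E t v" "\<And>u. u \<in> U \<Longrightarrow> E t u \<Longrightarrow> u = v"
  shows "two_active (insert v W) (U - {v}) s v b"
proof -
  note state = assms(1)[unfolded two_active_def] and active_in = two_active_in[OF assms(1)]
  have vertices_eq: "insert v W \<union> (U - {v}) = W \<union> U" using v(1) by auto
  have v_new: "v \<notin> W" using state v(1) by blast
  have "conn E (insert v W - {b}) s t" by (rule conn_mono[of _ "W - {b}"]) (use state in blast)+
  then have "conn E (insert v W - {b}) s v"
    by (rule conn_step) (use v(2) active_in v_new in blast)+
  moreover have "conn E (insert v W - {v}) s b"
    by (rule conn_mono[of _ "W - {t}"]) (use state v_new in blast)+
  moreover have "w = v \<or> w = b" if "w \<in> insert v W" "u \<in> U - {v}" "E w u" for w u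
    using that state v(3)[of u] by blast
  moreover have "s \<noteq> v" "v \<noteq> b" using state v_new active_in by blast+
  ultimately show ?thesis using state unfolding two_active_def vertices_eq by blast
qed

lemma one_active_if_two_active:
  assumes "two_active W U s t b" and dead: "\<And>u. u \<in> U \<Longrightarrow> \<not> E t u"
  shows "one_active U b"
proof -
  note state = assms(1)[unfolded two_active_def] and bW = two_active_in(2)[OF assms(1)]
  have lift: "conn_avoiding E (W \<union> U) s y z" if "conn_avoiding E (insert b U) b y z" "z \<in> U" for y z
  proof -
    have "b \<notin> nbhd E z" using conn_avoiding_in(3)[OF that(1)] .
    then have "W \<subseteq> W \<union> U - nbhd E z" using state that(2) dead sym unfolding nbhd_def by blast
    then have "conn E (W \<union> U - nbhd E z) s b"
      using state conn_mono[of E "W - {t}" s b] by blast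
    moreover have "conn E (W \<union> U - nbhd E z) b y"
      using that(1) bW unfolding conn_avoiding_def by (auto elim!: conn_mono)
    ultimately show ?thesis unfolding conn_avoiding_def by (rule conn_trans)
  qed
  have "z \<in> U" if "conn_avoiding E (insert b U) b y z" "z \<in> insert b U" for y z
    using that conn_avoiding_in(3)[OF that(1)] by (auto simp: nbhd_def)
  then have "admissible E (insert b U) b"
    using lift state unfolding admissible_def by (metis Un_iff insertI1)
  moreover have "\<not> has_AT E (insert b U)"
    using state bW has_AT_mono[of E "insert b U" "W \<union> U"] by blast
  ultimately show ?thesis using state bW unfolding one_active_def by blast
qed

lemma two_active_conn_avoiding:
  assumes "two_active W U s t b" "x \<in> U" "y \<in> U" "E t x" "\<not> E t y" "\<not> E x y" "x \<noteq> y"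
  shows "conn_avoiding E (W \<union> U) s x y"
proof -
  note state = assms(1)[unfolded two_active_def]
  have "W - {b} \<subseteq> W \<union> U - nbhd E y" using state assms(3,5) sym unfolding nbhd_def by blast
  then have "conn E (W \<union> U - nbhd E y) s t" using state conn_mono by metis
  moreover have "x \<in> W \<union> U - nbhd E y" using assms sym unfolding nbhd_def by blast
  ultimately show ?thesis unfolding conn_avoiding_def using assms(4) conn_step by metis
qed

lemma two_active_progress:
  assumes "two_active W U s t b"
  shows "\<exists>v. (\<forall>u\<in>U. E t u \<longrightarrow> u = v) \<or> (\<forall>u\<in>U. E b u \<longrightarrow> u = v)"
proof (rule ccontr)
  assume "\<not> ?thesis"
  then obtain x1 x2 y1 y2 where
    x: "x1 \<in> U" "x2 \<in> U" "x1 \<noteq> x2" "E t x1" "E t x2" and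
    y: "y1 \<in> U" "y2 \<in> U" "y1 \<noteq> y2" "E b y1" "E b y2" by metis
  note state = assms[unfolded two_active_def] and active_in = two_active_in[OF assms]
  let ?S = "component E (W - {t, b}) s"
  have S: "connected_set E ?S" by (rule connected_set_component[OF symp]) (use state in blast)
  have diff_eqs: "W - {b} - {t} = W - {t, b}" "W - {t} - {b} = W - {t, b}" by auto
  have touches: "touches E {t} ?S" "touches E {b} ?S"
    using conn_last_edge[of E "W - {b}" s t] conn_last_edge[of E "W - {t}" s b] state sym
    unfolding diff_eqs component_def by auto
  have "\<exists>x\<in>U. \<exists>y\<in>U. E t x \<and> \<not> E b x \<and> E b y \<and> \<not> E t y \<and> \<not> E x y"
    by (rule ex_nonadjacent_private_nbrs[OF _ _ _ S _ touches x y])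
       (use state active_in component_subset[of E "W - {t, b}" s] in blast)+
  then obtain x y where xy: "x \<in> U" "y \<in> U" "E t x" "\<not> E b x" "E b y" "\<not> E t y" "\<not> E x y" by blast
  have "conn_avoiding E (W \<union> U) s x y" "conn_avoiding E (W \<union> U) s y x"
    using two_active_conn_avoiding[OF assms, of x y] xy sym
      two_active_conn_avoiding[OF two_active_commute[OF assms], of y x] by metis+
  then show False using state xy unfolding admissible_def by blast
qed

end

text \<open>Here \<open>b\<close> is the only active vertex. The sweep has to consume all neighbours of \<open>b\<close> but two,
  which are active afterwards, before it can leave \<open>b\<close>. The neighbours of \<open>b\<close> induce a linear
  forest.\<close>

locale fan = K23_K4_free +
  fixes U :: "'a set" and b :: 'a
  assumes one_active: "one_active U b"
begin

definition rim :: "'a set" where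
  "rim = {f \<in> U. E b f}"

definition beyond :: "'a set" where
  "beyond = U - rim"

definition gates :: "'a set" where
  "gates = {f \<in> rim. \<exists>z\<in>beyond. E f z}"

definition exit_pair :: "'a \<Rightarrow> 'a \<Rightarrow> bool" where
  "exit_pair p q \<longleftrightarrow> p \<in> rim \<and> q \<in> rim \<and> p \<noteq> q \<and> gates \<subseteq> {p, q} \<and>
     (\<forall>u\<in>rim. E q u \<longrightarrow> u = p) \<and> leaf_in E (rim - {q}) p"

lemma hub_notin: "b \<notin> U"
  using one_active by (simp add: one_active_def)

lemma finite_rim: "finite rim"
  using one_active by (simp add: one_active_def rim_def)

lemma rimD:
  assumes "f \<in> rim" shows "f \<in> U" "E b f" "E f b" "f \<noteq> b" "f \<notin> beyond"
  using assms hub_notin sym unfolding rim_def beyond_def by blast+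

lemma beyondD:
  assumes "z \<in> beyond" shows "z \<in> U" "\<not> E b z" "\<not> E z b" "z \<noteq> b" "z \<notin> rim"
proof -
  show "z \<in> U" "\<not> E b z" "z \<noteq> b" "z \<notin> rim" using assms hub_notin by (auto simp: rim_def beyond_def)
  then show "\<not> E z b" using sym by blast
qed

lemma gatesD: "d \<in> gates \<Longrightarrow> d \<in> rim"
  by (simp add: gates_def)

lemma not_adjacent_beyond_if_not_gate:
  assumes "f \<in> rim" "f \<notin> gates" "z \<in> beyond" shows "\<not> E f z" "\<not> E z f"
  using assms sym unfolding gates_def by blast+

lemma no_mutual_conn_avoiding:
  assumes "y \<in> U" "z \<in> U" "conn_avoiding E (insert b U) b y z"
  shows "\<not> conn_avoiding E (insert b U) b z y"
  using one_active assms unfolding one_active_def admissible_def by blast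

lemma no_asteroidal_triple:
  assumes "conn_avoiding E (insert b U) x y z" "conn_avoiding E (insert b U) y z x"
  shows "\<not> conn_avoiding E (insert b U) x z y"
  using one_active has_ATI[OF assms] unfolding one_active_def by blast

lemma conn_avoiding_if_successively:
  assumes "successively E xs" "xs \<noteq> []" "set xs \<subseteq> insert b U - nbhd E z"
  shows "conn_avoiding E (insert b U) (hd xs) (last xs) z"
  unfolding conn_avoiding_def
  using assms(2)
    conn_if_connected_set[OF connected_set_if_successively[OF symp assms(1,2)] assms(3)]
  by simp

lemma rim_degree_le_2:
  assumes "{f, u, v, w} \<subseteq> rim" "E f u" "E f v" "E f w"
  shows "u = v \<or> u = w \<or> v = w"
proof (rule ccontr)
  assume "\<not> ?thesis"
  moreover have "f \<notin> {u, v, w}" "b \<notin> {f, u, v, w}" using assms rimD(4) irrefl by blast+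
  ultimately have "distinct [b, f, u, v, w]" by simp
  then show False using assms rimD(2) by (intro not_K23_subgraph[of b f u v w]) auto
qed

lemma rim_triangle_free:
  assumes "{u, v, w} \<subseteq> rim" "E u v" "E v w" shows "\<not> E u w"
  using assms rimD(2) not_K4[of b u v w] by blast

lemma rim_path_hd_not_adjacent:
  assumes path: "distinct (x # y # zs)" "successively E (x # y # zs)" "set (x # y # zs) \<subseteq> rim"
    and u: "u \<in> set zs"
  shows "\<not> E x u"
proof
  assume "E x u"
  obtain ps qs where zs: "zs = ps @ u # qs" using u by (meson split_list)
  have rim: "x \<in> rim" "y \<in> rim" "u \<in> rim" "set ps \<subseteq> rim" using path(3) zs by auto
  have "E x y" using path(2) by simp
  show False
  proof (cases "ps = []")
    case True
    then have "E y u" using path(2) zs by simp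
    then show False using rim_triangle_free[of x y u] rim \<open>E x y\<close> \<open>E x u\<close> by blast
  next
    case False
    have "successively E ps" "E y (hd ps)" "E (last ps) u"
      using path(2) zs False by (auto simp: successively_append_iff successively_Cons)
    moreover have "hd ps \<in> set ps" "last ps \<in> set ps" using False by simp_all
    ultimately have "touches E (set ps) {y}" "touches E (set ps) {u}" "touches E (set ps) {b}"
      "connected_set E (set ps)"
      using False rim(4) rimD(3) sym connected_set_if_successively[OF symp]
      unfolding touches_def by blast+
    moreover have "x \<noteq> b" "y \<noteq> b" "u \<noteq> b" "b \<notin> set ps" "E x b" using rim rimD(3,4) by blast+
    ultimately have "K23_model E {x} (set ps) {y} {u} {b}"
      using path(1) zs \<open>E x y\<close> \<open>E x u\<close>
      by (auto simp: K23_model_def disjnt_def connected_set_singleton)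
    then show False using not_K23_model by blast
  qed
qed

lemma ex_leaf_in_rim:
  assumes "X \<subseteq> rim" "X \<noteq> {}" shows "\<exists>x\<in>X. leaf_in E X x"
proof -
  let ?path = "\<lambda>xs. xs \<noteq> [] \<and> distinct xs \<and> set xs \<subseteq> X \<and> successively E xs"
  have "finite X" using assms(1) finite_rim finite_subset by blast
  then have "\<forall>xs. ?path xs \<longrightarrow> length xs < Suc (card X)"
    by (metis card_mono distinct_card le_imp_less_Suc)
  moreover obtain x0 where "x0 \<in> X" using assms(2) by blast
  then have "?path [x0]" by simp
  ultimately obtain xs where path: "?path xs" and longest: "\<And>ys. ?path ys \<Longrightarrow> length ys \<le> length xs"
    using ex_has_greatest_nat[of ?path "[x0]" length "Suc (card X)"] by (metis (no_types, lifting))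
  obtain x ys where xs: "xs = x # ys" using path by (cases xs) auto
  have nbr_in: "u \<in> set ys" if "u \<in> X" "E x u" for u
  proof (rule ccontr)
    assume "u \<notin> set ys"
    then have "?path (u # xs)" using path xs that sym irrefl by auto
    then show False using longest by fastforce
  qed
  have "u = hd ys" if "u \<in> X" "E x u" for u
    using nbr_in[OF that] rim_path_hd_not_adjacent[of x "hd ys" "tl ys" u] path xs that assms(1)
    by (cases ys) auto
  then show ?thesis using path xs unfolding leaf_in_def by (intro bexI[of _ x]) auto
qed

lemma leaf_in_rim_if_adjacent:
  assumes "p \<in> rim" "q \<in> rim" "E p q" shows "leaf_in E (rim - {q}) p"
  using rim_degree_le_2[of p _ _ q] assms unfolding leaf_in_def by blast

lemma ex_next_leaf:
  assumes "R \<subseteq> rim" "p \<in> R" "leaf_in E R p" "R \<noteq> {p}"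
  shows "\<exists>p'\<in>R - {p}. leaf_in E (R - {p}) p' \<and> (\<forall>u\<in>R. E p u \<longrightarrow> u = p')"
proof (cases "\<exists>p'\<in>R. E p p'")
  case True
  then obtain p' where p': "p' \<in> R" "E p p'" by blast
  have "leaf_in E (rim - {p}) p'" using assms(1,2) p' sym by (intro leaf_in_rim_if_adjacent) auto
  then have "leaf_in E (R - {p}) p'" using assms(1) unfolding leaf_in_def by blast
  then show ?thesis using p' assms(3) irrefl unfolding leaf_in_def by (intro bexI[of _ p']) blast+
next
  case False
  have "R - {p} \<noteq> {}" using assms(2,4) by blast
  then show ?thesis using ex_leaf_in_rim[of "R - {p}"] assms(1) False by blast
qed

lemma ex_forward_ordering:
  assumes "R \<subseteq> rim" "p \<in> R" "leaf_in E R p"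
  shows "\<exists>rs. forward_ordering E rs \<and> distinct rs \<and> set rs = R \<and> rs \<noteq> [] \<and> last rs = p"
proof -
  have "finite R" using assms(1) finite_rim finite_subset by blast
  then show ?thesis using assms
  proof (induction R arbitrary: p rule: finite_psubset_induct)
    case (psubset R)
    show ?case
    proof (cases "R = {p}")
      case True
      then show ?thesis by (intro exI[of _ "[p]"]) simp
    next
      case False
      obtain p' where p': "p' \<in> R - {p}" "leaf_in E (R - {p}) p'" "\<And>u. u \<in> R \<Longrightarrow> E p u \<Longrightarrow> u = p'"
        using ex_next_leaf[OF psubset.prems False] by blast
      have "R - {p} \<subset> R" using psubset.prems(2) by blast
      then obtain rs where rs: "forward_ordering E rs" "distinct rs" "set rs = R - {p}"
        "rs \<noteq> []" "last rs = p'"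
        using psubset.IH[of "R - {p}" p'] p'(1,2) psubset.prems(1) by blast
      have "\<not> E u p" if "u \<in> set (butlast rs)" for u
        using neq_last_if_in_butlast[OF rs(2) that] in_set_butlastD[OF that] p'(3) sym rs(3,5)
        by blast
      then have "forward_ordering E (rs @ [p])" by (rule forward_ordering_snoc[OF rs(1)])
      then show ?thesis using rs psubset.prems(2) by (intro exI[of _ "rs @ [p]"]) auto
    qed
  qed
qed

lemma adjacent_if_distinct_components:
  assumes "f \<in> rim" "f' \<in> rim" "z \<in> beyond" "z' \<in> beyond" "E f z" "E f' z'" "\<not> conn E beyond z z'"
  shows "E f z' \<or> E f' z"
proof (rule ccontr)
  assume nonadj: "\<not> (E f z' \<or> E f' z)"
  have apart: "\<not> E z z'" "z \<noteq> z'"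
    using assms conn_edge[of z beyond z' E] conn_refl[of z beyond E] by auto
  have "conn_avoiding E (insert b U) (hd [b, f, z]) (last [b, f, z]) z'"
    by (rule conn_avoiding_if_successively)
       (use assms nonadj apart rimD beyondD sym in \<open>auto simp: nbhd_def\<close>)
  moreover have "conn_avoiding E (insert b U) (hd [b, f', z']) (last [b, f', z']) z"
    by (rule conn_avoiding_if_successively)
       (use assms nonadj apart rimD beyondD sym in \<open>auto simp: nbhd_def\<close>)
  ultimately show False using no_mutual_conn_avoiding assms(3,4) beyondD(1) by auto
qed

lemma rim_attachments_le_2:
  assumes Q: "connected_set E Q" "Q \<subseteq> beyond" and rim: "{d1, d2, d3} \<subseteq> rim"
    and touches: "touches E {d1} Q" "touches E {d2} Q" "touches E {d3} Q"
  shows "d1 = d2 \<or> d1 = d3 \<or> d2 = d3"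
proof (rule ccontr)
  assume "\<not> ?thesis"
  moreover have "b \<notin> Q" "Q \<inter> {d1, d2, d3} = {}" using Q(2) rim rimD(5) beyondD(4) by blast+
  moreover have "b \<notin> {d1, d2, d3}" "E b d1" "E b d2" "E b d3" using rim rimD(2,4) by blast+
  ultimately have "K23_model E {b} Q {d1} {d2} {d3}"
    using Q(1) touches sym by (auto simp: K23_model_def disjnt_def connected_set_singleton)
  then show False using not_K23_model by blast
qed

lemma component_beyond:
  assumes "z \<in> beyond"
  shows "connected_set E (component E beyond z)" "component E beyond z \<subseteq> beyond"
    "z \<in> component E beyond z"
  using assms by (simp_all add: connected_set_component[OF symp] component_subset in_component_self)

lemma rim_common_nbrs_le_2:
  assumes "{d1, d2, d3} \<subseteq> rim" "distinct [d1, d2, d3]" "w \<in> beyond"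
  shows "\<not> (E d1 w \<and> E d2 w \<and> E d3 w)"
  using rim_attachments_le_2[OF connected_set_singleton[of E w] _ assms(1)] assms(2,3) by auto

lemma gates_in_distinct_components:
  assumes rim: "{d1, d2, d3} \<subseteq> rim" and distinct: "distinct [d1, d2, d3]"
    and z: "{z1, z2, z3} \<subseteq> beyond" "E d1 z1" "E d2 z2" "E d3 z3"
  shows "\<not> conn E beyond z1 z2"
proof
  assume same: "conn E beyond z1 z2"
  let ?Q = "component E beyond z1"
  have Q: "connected_set E ?Q" "?Q \<subseteq> beyond" "z1 \<in> ?Q"
    using component_beyond[of z1] z(1) by simp_all
  have z2Q: "z2 \<in> ?Q" using same by (simp add: component_def)
  have "touches E {d1} ?Q" "touches E {d2} ?Q" using Q(3) z2Q z(2,3) by auto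
  then have d3: "\<not> touches E {d3} ?Q"
    using rim_attachments_le_2[OF Q(1,2) rim] distinct by auto
  then have "\<not> conn E beyond z1 z3" using z(4) by (auto simp: component_def)
  moreover from this have "\<not> conn E beyond z2 z3" using same conn_trans by metis
  moreover have "\<not> E d3 z1" "\<not> E d3 z2" using d3 Q(3) z2Q by auto
  ultimately have "E d1 z3" "E d2 z3"
    using adjacent_if_distinct_components rim z by blast+
  then show False using rim_common_nbrs_le_2[OF rim distinct, of z3] z by simp
qed

lemma no_hexagon_through_beyond:
  assumes rim: "{d1, d2, d3} \<subseteq> rim" "distinct [d1, d2, d3]"
    and beyond: "{x, y, z} \<subseteq> beyond" "distinct [x, y, z]"
    and edges: "E d1 x" "E d2 x" "E d2 y" "E d3 y" "E d3 z" "E d1 z"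
  shows False
proof -
  have "connected_set E {z, d3, y}" using edges sym by (auto intro: connected_set_intros)
  moreover have "b \<notin> {d1, d2, d3, x, y, z}" using rim(1) beyond(1) rimD(4) beyondD(4) by blast
  moreover have "{d1, d2, d3} \<inter> {x, y, z} = {}" using rim(1) beyond(1) rimD(5) by blast
  moreover have "E d1 b" "E d2 b" using rim(1) rimD(3) by blast+
  ultimately have "K23_model E {d1} {d2} {x} {b} {z, d3, y}"
    using rim(2) beyond(2) edges by (auto simp: K23_model_def disjnt_def connected_set_singleton)
  then show False using not_K23_model by blast
qed

lemma gates_le_2:
  assumes "{d1, d2, d3} \<subseteq> gates" shows "d1 = d2 \<or> d1 = d3 \<or> d2 = d3"
proof (rule ccontr)
  assume "\<not> ?thesis"
  then have distinct: "distinct [d1, d2, d3]" by simp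
  have "\<exists>z\<in>beyond. E d z" if "d \<in> {d1, d2, d3}" for d
    using that assms unfolding gates_def by blast
  then obtain z1 z2 z3 where
    z: "z1 \<in> beyond" "z2 \<in> beyond" "z3 \<in> beyond" "E d1 z1" "E d2 z2" "E d3 z3"
    by (metis insertCI)
  have rim: "{d1, d2, d3} \<subseteq> rim" using assms gatesD by blast
  have apart: "\<not> conn E beyond z1 z2" "\<not> conn E beyond z1 z3" "\<not> conn E beyond z2 z3"
    using gates_in_distinct_components[of d1 d2 d3 z1 z2 z3]
      gates_in_distinct_components[of d1 d3 d2 z1 z3 z2]
      gates_in_distinct_components[of d2 d3 d1 z2 z3 z1] rim z distinct by auto
  then have z_distinct: "distinct [z1, z2, z3]" using z(1-3)[THEN conn_refl] by auto
  have cross: "E d1 z2 \<or> E d2 z1" "E d1 z3 \<or> E d3 z1" "E d2 z3 \<or> E d3 z2"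
    using adjacent_if_distinct_components rim z apart by blast+
  note no_common = rim_common_nbrs_le_2[OF rim distinct]
  show False
  proof (cases "E d1 z2")
    case True
    then have "E d2 z3" using cross(3) no_common[OF z(2)] z by blast
    moreover from this have "E d3 z1" using cross(2) no_common[OF z(3)] z by blast
    ultimately show False
      using no_hexagon_through_beyond[OF rim distinct, of z2 z3 z1] True z z_distinct by auto
  next
    case False
    then have "E d2 z1" using cross(1) by blast
    moreover from this have "E d1 z3" using cross(2) no_common[OF z(1)] z by blast
    moreover from this have "E d3 z2" using cross(3) no_common[OF z(3)] z by blast
    ultimately show False
      using no_hexagon_through_beyond[OF rim distinct, of z1 z2 z3] z z_distinct by auto
  qed
qed

lemma ex_exit_pair_if_leaf:
  assumes "q \<in> rim" "leaf_in E rim q" "rim \<noteq> {q}" "gates \<subseteq> {q}"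
  shows "\<exists>p. exit_pair p q"
  using ex_next_leaf[OF subset_refl assms(1-3)] assms(1,4) unfolding exit_pair_def by blast

text \<open>If \<open>u'\<close>, \<open>u\<close>, \<open>d\<close>, \<open>w\<close>, \<open>w'\<close> were a path in the rim, \<open>u'\<close>, \<open>w'\<close> and a vertex beyond \<open>d\<close> would
  be an asteroidal triple.\<close>

lemma gate_branch_one_sided:
  assumes gates: "gates = {d}" and u: "u \<in> rim" "E d u" and w: "w \<in> rim" "E d w" "u \<noteq> w"
  shows "(\<forall>u'\<in>rim. E u u' \<longrightarrow> u' = d) \<or> (\<forall>w'\<in>rim. E w w' \<longrightarrow> w' = d)"
proof (rule ccontr)
  assume "\<not> ?thesis"
  then obtain u' w' where u': "u' \<in> rim" "E u u'" "u' \<noteq> d" and w': "w' \<in> rim" "E w w'" "w' \<noteq> d"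
    by blast
  have "d \<in> gates" using gates by simp
  then obtain z where d: "d \<in> rim" and z: "z \<in> beyond" "E d z" unfolding gates_def by blast
  have neqs: "u \<noteq> d" "w \<noteq> d" "u' \<noteq> u" "w' \<noteq> w" using u w u' w' irrefl by auto
  have "\<not> E u w" using rim_triangle_free[of u d w] u w d sym by blast
  then have "u' \<noteq> w" "w' \<noteq> u" using u' w' sym by blast+
  moreover from this have "\<not> E u' w"
    using rim_path_hd_not_adjacent[of u' u "[d, w]" w] u u' w d neqs sym by auto
  then have "u' \<noteq> w'" using w'(2) sym by blast
  ultimately have path: "distinct [u', u, d, w, w']" using neqs u'(3) w'(3) w(3) by auto
  have nonadj: "\<not> E u' d" "\<not> E u' w" "\<not> E u' w'" "\<not> E w' d" "\<not> E w' u" "\<not> E w' u'"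
    using rim_path_hd_not_adjacent[of u' u "[d, w, w']"]
      rim_path_hd_not_adjacent[of w' w "[d, u, u']"] path u w u' w' d sym by auto
  have far: "\<not> E u z" "\<not> E z u" "\<not> E w z" "\<not> E z w" "\<not> E u' z" "\<not> E z u'" "\<not> E w' z" "\<not> E z w'"
    using not_adjacent_beyond_if_not_gate z(1) gates u(1) w(1) u'(1) w'(1) path by auto
  note vertex_facts =
    rimD[OF u(1)] rimD[OF w(1)] rimD[OF u'(1)] rimD[OF w'(1)] rimD[OF d] beyondD[OF z(1)]
  have "conn_avoiding E (insert b U) (hd [u', b, w']) (last [u', b, w']) z"
    by (rule conn_avoiding_if_successively) (use vertex_facts far z(1) in \<open>auto simp: nbhd_def\<close>)
  moreover have "conn_avoiding E (insert b U) (hd [u', u, d, z]) (last [u', u, d, z]) w'"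
    by (rule conn_avoiding_if_successively)
       (use vertex_facts far nonadj path z u u' sym in \<open>auto simp: nbhd_def\<close>)
  moreover have "conn_avoiding E (insert b U) (hd [w', w, d, z]) (last [w', w, d, z]) u'"
    by (rule conn_avoiding_if_successively)
       (use vertex_facts far nonadj path z w w' sym in \<open>auto simp: nbhd_def\<close>)
  ultimately show False using no_asteroidal_triple[of u' w' z] by simp
qed

lemma ex_exit_pair_if_branching_gate:
  assumes gates: "gates = {d}" and "\<not> leaf_in E rim d"
  shows "\<exists>q. exit_pair d q"
proof -
  have d: "d \<in> rim" using gates gatesD by blast
  obtain u w where uw: "u \<in> rim" "w \<in> rim" "E d u" "E d w" "u \<noteq> w"
    using assms(2) unfolding leaf_in_def by blast
  have "u \<noteq> d" "w \<noteq> d" using uw irrefl by auto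
  moreover have "leaf_in E (rim - {u}) d" "leaf_in E (rim - {w}) d"
    using uw(1-4) d sym by (auto intro: leaf_in_rim_if_adjacent)
  moreover have "(\<forall>x\<in>rim. E u x \<longrightarrow> x = d) \<or> (\<forall>x\<in>rim. E w x \<longrightarrow> x = d)"
    using gate_branch_one_sided[OF gates] uw by blast
  ultimately show ?thesis using gates d uw(1,2) unfolding exit_pair_def by blast
qed

lemma leaf_in_rim_if_linked_beyond:
  assumes d: "d \<in> rim" "d' \<in> rim" "d \<noteq> d'"
    and Q: "connected_set E Q" "Q \<subseteq> beyond" "touches E {d} Q" "touches E {d'} Q"
  shows "leaf_in E (rim - {d'}) d"
  unfolding leaf_in_def
proof (intro ballI impI, rule ccontr)
  fix u u' assume u: "u \<in> rim - {d'}" "u' \<in> rim - {d'}" "E d u" "E d u'" "u \<noteq> u'"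
  obtain y where "y \<in> Q" "E d' y" using Q(4) by auto
  then have "connected_set E (insert d' Q)" by (rule connected_set_insert[OF symp Q(1)])
  moreover have "b \<notin> Q" "Q \<inter> {d, d', u, u'} = {}" using d u Q(2) rimD(5) beyondD(4) by blast+
  moreover have "b \<notin> {d, d', u, u'}" "E b d" "E b d'" "E b u" "E b u'" using d u rimD(2,4) by blast+
  moreover have "u \<noteq> d" "u' \<noteq> d" using u irrefl by auto
  ultimately have "K23_model E {b} {d} {u} {u'} (insert d' Q)"
    using d u Q(3) by (auto simp: K23_model_def disjnt_def connected_set_singleton)
  then show False using not_K23_model by blast
qed

text \<open>Otherwise \<open>u\<close>, \<open>w\<close> and a neighbour of \<open>d\<close> in \<open>Q\<close> are an asteroidal triple.\<close>

lemma linked_gates_one_sided: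
  assumes d: "d \<in> rim" "d' \<in> rim" "d \<noteq> d'" "gates \<subseteq> {d, d'}"
    and Q: "connected_set E Q" "Q \<subseteq> beyond" "touches E {d} Q" "touches E {d'} Q"
  shows "(\<forall>u\<in>rim. E d u \<longrightarrow> u = d') \<or> (\<forall>w\<in>rim. E d' w \<longrightarrow> w = d)"
proof (rule ccontr)
  assume "\<not> ?thesis"
  then obtain u w where u: "u \<in> rim" "E d u" "u \<noteq> d'" and w: "w \<in> rim" "E d' w" "w \<noteq> d" by blast
  obtain z z' where z: "z \<in> Q" "E d z" and z': "z' \<in> Q" "E d' z'" using Q(3,4) by auto
  note vertex_facts = rimD[OF d(1)] rimD[OF d(2)] rimD[OF u(1)] rimD[OF w(1)]
  have outside: "Q \<inter> {d, d', b, u, w} = {}" using d u w Q(2) rimD(5) beyondD(4) by blast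
  have neqs: "u \<noteq> d" "w \<noteq> d'" using u w irrefl by auto
  have "\<not> E d' u" "\<not> E d w"
    using common_nbr_unique[OF d(3) Q(1,3,4), of _ b] outside vertex_facts u w by blast+
  then have "u \<noteq> w" using w(2) by blast
  have "\<not> E u w"
    by (rule common_nbr_separates[OF d(3) Q(1,3,4), of b]) (use outside vertex_facts u w in auto)
  have far: "\<not> E u y" "\<not> E y u" "\<not> E w y" "\<not> E y w" if "y \<in> Q" for y
    using not_adjacent_beyond_if_not_gate that Q(2) d(4) u w neqs by blast+
  have QU: "Q \<subseteq> U" using Q(2) beyondD(1) by blast
  have "conn_avoiding E (insert b U) (hd [u, b, w]) (last [u, b, w]) z"
    by (rule conn_avoiding_if_successively)
       (use far[OF z(1)] z(1) vertex_facts outside Q(2) beyondD(2,3) in \<open>auto simp: nbhd_def\<close>)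
  moreover have "conn_avoiding E (insert b U) (hd [u, d, z]) (last [u, d, z]) w"
    by (rule conn_avoiding_if_successively)
       (use far[OF z(1)] z QU vertex_facts outside u w \<open>u \<noteq> w\<close> \<open>\<not> E u w\<close> \<open>\<not> E d w\<close> sym
        in \<open>auto simp: nbhd_def\<close>)
  moreover have "conn_avoiding E (insert b U) w z u"
  proof -
    have "conn_avoiding E (insert b U) (hd [w, d', z']) (last [w, d', z']) u"
      by (rule conn_avoiding_if_successively)
         (use far[OF z'(1)] z' QU vertex_facts outside u w \<open>u \<noteq> w\<close> \<open>\<not> E u w\<close> \<open>\<not> E d' u\<close> sym
          in \<open>auto simp: nbhd_def\<close>)
    moreover have "Q \<subseteq> insert b U - nbhd E u" using QU far outside unfolding nbhd_def by blast
    then have "conn_avoiding E (insert b U) z' z u"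
      using conn_if_connected_set[OF Q(1)] z'(1) z(1) unfolding conn_avoiding_def by blast
    ultimately show ?thesis unfolding conn_avoiding_def by (auto intro: conn_trans)
  qed
  ultimately show False using no_asteroidal_triple[of u w z] by simp
qed

lemma ex_exit_pair_if_two_gates:
  assumes gates: "d \<in> gates" "d' \<in> gates" "d \<noteq> d'"
  shows "\<exists>p q. exit_pair p q"
proof -
  have gates_sub: "gates \<subseteq> {d, d'}" using gates_le_2[of d d'] gates by blast
  have d: "d \<in> rim" "d' \<in> rim" using gates gatesD by blast+
  have "\<exists>z\<in>beyond. \<exists>z'\<in>beyond. E d z \<and> E d' z' \<and> conn E beyond z z'"
  proof -
    obtain z z' where z: "z \<in> beyond" "z' \<in> beyond" "E d z" "E d' z'"
      using gates unfolding gates_def by blast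
    then consider "conn E beyond z z'" | "E d z'" | "E d' z"
      using adjacent_if_distinct_components[OF d] by blast
    then show ?thesis by cases (use z conn_refl in metis)+
  qed
  then obtain z z' where z: "z \<in> beyond" "E d z" "E d' z'" "conn E beyond z z'" by blast
  let ?Q = "component E beyond z"
  have Q: "connected_set E ?Q" "?Q \<subseteq> beyond" "touches E {d} ?Q" "touches E {d'} ?Q"
    using component_beyond[OF z(1)] z(2-4) by (auto simp: component_def)
  have "leaf_in E (rim - {d'}) d" "leaf_in E (rim - {d}) d'"
    using leaf_in_rim_if_linked_beyond[OF d gates(3) Q]
      leaf_in_rim_if_linked_beyond[OF d(2,1) gates(3)[symmetric] Q(1,2,4,3)] by blast+
  then have "exit_pair d' d \<or> exit_pair d d'"
    using linked_gates_one_sided[OF d gates(3) gates_sub Q] d gates(3) gates_sub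
    unfolding exit_pair_def by blast
  then show ?thesis by blast
qed

lemma ex_exit_pair:
  assumes "rim \<noteq> {}" "\<And>f. rim \<noteq> {f}" shows "\<exists>p q. exit_pair p q"
proof -
  consider (none) "gates = {}" | (one) d where "gates = {d}"
    | (two) d d' where "d \<in> gates" "d' \<in> gates" "d \<noteq> d'" by blast
  then show ?thesis
  proof cases
    case none
    obtain q where "q \<in> rim" "leaf_in E rim q"
      using ex_leaf_in_rim[OF subset_refl assms(1)] by blast
    then show ?thesis using ex_exit_pair_if_leaf assms(2) none by blast
  next
    case one
    then show ?thesis
      using ex_exit_pair_if_leaf[of d] ex_exit_pair_if_branching_gate[of d] assms(2) gatesD by blast
  next
    case two
    then show ?thesis by (rule ex_exit_pair_if_two_gates)
  qed
qed

lemma two_active_if_exit_pair: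
  assumes "exit_pair p q" shows "two_active (insert b rim) beyond b p q"
proof -
  note exit = assms[unfolded exit_pair_def] and hub = one_active[unfolded one_active_def]
  have vertices_eq: "insert b rim \<union> beyond = insert b U" by (auto simp: rim_def beyond_def)
  have neqs: "b \<noteq> p" "b \<noteq> q" using exit rimD(4) by blast+
  have "conn E (insert b rim - {q}) b p" "conn E (insert b rim - {p}) b q"
    by (rule conn_edge; use exit neqs rimD(2) in blast)+
  moreover have "w = p \<or> w = q" if "w \<in> insert b rim" "z \<in> beyond" "E w z" for w z
    using that exit beyondD(2) unfolding gates_def by blast
  moreover have "finite beyond" "insert b rim \<inter> beyond = {}"
    using hub beyondD(4,5) by (auto simp: beyond_def)
  ultimately show ?thesis using hub exit neqs unfolding two_active_def vertices_eq by blast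
qed

lemma sweepable_if_exit_pair:
  assumes "exit_pair p q" and rest: "sweepable E beyond (Some p) (Some q)"
    and dead: "unprocessed_nbrs E U t = {}"
  shows "sweepable E U t (Some b)"
proof -
  note exit = assms(1)[unfolded exit_pair_def]
  obtain rs where rs: "forward_ordering E rs" "distinct rs" "set rs = rim - {q}"
    "rs \<noteq> []" "last rs = p"
    using ex_forward_ordering[of "rim - {q}" p] exit by blast
  have rest: "sweepable E (U - set rs) (Some (last rs)) (Some b)"
    unfolding rs(5)
  proof (rule sweepable_bottom)
    show "q \<in> U - set rs" using exit rimD(1) rs(3) by blast
    show "unprocessed_nbrs E (U - set rs) (Some b) \<subseteq> {q}" using rs(3) by (auto simp: rim_def)
    have "U - set rs - {q} = beyond" unfolding beyond_def rs(3) using exit by blast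
    then show "sweepable E (U - set rs - {q}) (Some p) (Some q)" using rest by simp
  qed
  show ?thesis
  proof (rule sweepable_if_forward_ordering[OF rs(1,4,2) _ _ _ rest])
    show "set rs \<subseteq> U" using rs(3) rimD(1) by blast
    show "unprocessed_nbrs E U t \<subseteq> {hd rs}" using dead by simp
    show "unprocessed_nbrs E U (Some r) \<subseteq> set rs" if "r \<in> set (butlast rs)" for r
    proof -
      have r: "r \<in> rim - {q}" using in_set_butlastD[OF that] rs(3) by blast
      have "r \<noteq> p" using neq_last_if_in_butlast[OF rs(2) that] rs(5) by simp
      then have "u \<in> rim - {q}" if "u \<in> U" "E r u" for u
        using r exit that sym not_adjacent_beyond_if_not_gate[of r u] unfolding beyond_def by blast
      then show ?thesis using rs(3) by auto
    qed
  qed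
qed

end

context K23_K4_free
begin

definition states_sweepable :: "'a set \<Rightarrow> bool" where
  "states_sweepable U \<longleftrightarrow>
     (\<forall>t b. one_active U b \<longrightarrow> unprocessed_nbrs E U t = {} \<longrightarrow> sweepable E U t (Some b)) \<and>
     (\<forall>W s t b. two_active W U s t b \<longrightarrow> sweepable E U (Some t) (Some b))"

context
  fixes U :: "'a set"
  assumes smaller: "\<And>U'. U' \<subset> U \<Longrightarrow> states_sweepable U'"
begin

lemma smaller_one_active:
  "U' \<subset> U \<Longrightarrow> one_active U' b \<Longrightarrow> unprocessed_nbrs E U' t = {} \<Longrightarrow> sweepable E U' t (Some b)"
  using smaller[of U', unfolded states_sweepable_def] by metis

lemma smaller_two_active:
  "U' \<subset> U \<Longrightarrow> two_active W U' s t b \<Longrightarrow> sweepable E U' (Some t) (Some b)"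
  using smaller[of U', unfolded states_sweepable_def] by metis

lemma sweepable_if_none_active:
  assumes "finite U" "\<not> has_AT E U" "unprocessed_nbrs E U t = {}" "unprocessed_nbrs E U b = {}"
  shows "sweepable E U t b"
proof (cases "U = {}")
  case True
  then show ?thesis by (simp add: sweepable_empty)
next
  case False
  then obtain s where s: "admissible E U s" using ex_admissible[OF symp] assms(1,2) by blast
  then have s_in: "s \<in> U" by (simp add: admissible_def)
  then have "insert s (U - {s}) = U" by auto
  then have "one_active (U - {s}) s" unfolding one_active_def using assms(1,2) s by simp
  moreover have "unprocessed_nbrs E (U - {s}) t = {}"
    using assms(3) unprocessed_nbrs_mono[of "U - {s}" U E t] by auto
  ultimately have "sweepable E (U - {s}) t (Some s)" using s_in by (intro smaller_one_active) auto
  then show ?thesis using sweepable_bottom[OF s_in] assms(4) by simp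
qed

lemma sweepable_if_one_active:
  assumes state: "one_active U b" and dead: "unprocessed_nbrs E U t = {}"
  shows "sweepable E U t (Some b)"
proof -
  interpret fan E U b by unfold_locales (rule state)
  have finite: "finite U" and no_AT: "\<not> has_AT E U"
    using state has_AT_mono[of E U "insert b U"] by (auto simp: one_active_def)
  consider (none) "rim = {}" | (one) m where "rim = {m}" | (many) "rim \<noteq> {}" "\<And>f. rim \<noteq> {f}"
    by blast
  then show ?thesis
  proof cases
    case none
    then show ?thesis
      using sweepable_if_none_active[OF finite no_AT dead] by (simp add: rim_def)
  next
    case (one m)
    then have m: "m \<in> U" "E b m" "\<And>u. u \<in> U \<Longrightarrow> E b u \<Longrightarrow> u = m" unfolding rim_def by auto
    have "unprocessed_nbrs E (U - {m}) t = {}"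
      using dead unprocessed_nbrs_mono[of "U - {m}" U E t] by auto
    then have "sweepable E (U - {m}) t (Some m)"
      using one_active_advance[OF state m] m(1) by (intro smaller_one_active) auto
    then show ?thesis using sweepable_bottom[OF m(1)] one by (simp add: rim_def)
  next
    case many
    then obtain p q where exit: "exit_pair p q" using ex_exit_pair by blast
    then have "p \<in> U" "p \<notin> beyond" using rimD(1,5)[of p] by (simp_all add: exit_pair_def)
    then have "beyond \<subset> U" by (auto simp: beyond_def)
    then have "sweepable E beyond (Some p) (Some q)"
      using two_active_if_exit_pair[OF exit] by (rule smaller_two_active)
    then show ?thesis using dead by (rule sweepable_if_exit_pair[OF exit])
  qed
qed

lemma sweepable_if_top_advances:
  assumes state: "two_active W U s t b" and v: "\<forall>u\<in>U. E t u \<longrightarrow> u = v"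
  shows "sweepable E U (Some t) (Some b)"
proof (cases "\<exists>u\<in>U. E t u")
  case True
  then have v': "v \<in> U" "E t v" using v by auto
  then have "two_active (insert v W) (U - {v}) s v b"
    using v by (intro two_active_advance[OF state]) blast+
  moreover have "U - {v} \<subset> U" using v'(1) by blast
  ultimately have "sweepable E (U - {v}) (Some v) (Some b)" by (intro smaller_two_active)
  moreover have "unprocessed_nbrs E U (Some t) \<subseteq> {v}" using v by auto
  ultimately show ?thesis by (intro sweepable_top[OF v'(1)])
next
  case False
  then have "one_active U b" by (intro one_active_if_two_active[OF state]) blast
  then show ?thesis using False by (intro sweepable_if_one_active) auto
qed

lemma sweepable_if_two_active:
  assumes state: "two_active W U s t b" shows "sweepable E U (Some t) (Some b)"
  using two_active_progress[OF state] sweepable_if_top_advances[OF state]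
    sweepable_if_top_advances[OF two_active_commute[OF state]] sweepable_commute by blast

end

lemma states_sweepable: "finite U \<Longrightarrow> states_sweepable U"
proof (induction U rule: finite_psubset_induct)
  case (psubset U)
  then show ?case
    using sweepable_if_one_active[of U] sweepable_if_two_active[of U]
    unfolding states_sweepable_def[of U] by simp
qed

lemma ex_sweepable_from:
  assumes "finite V" "V \<noteq> {}" "\<not> has_AT E V"
  shows "\<exists>s\<in>V. sweepable E (V - {s}) (Some s) None"
proof -
  obtain s where s: "admissible E V s" using ex_admissible[OF symp assms] by blast
  then have s_in: "s \<in> V" by (simp add: admissible_def)
  then have "insert s (V - {s}) = V" by auto
  then have "one_active (V - {s}) s" unfolding one_active_def using assms(1,3) s by simp
  then have "sweepable E (V - {s}) None (Some s)"
    using states_sweepable[of "V - {s}"] assms(1)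
    by (simp add: states_sweepable_def unprocessed_nbrs_def)
  then show ?thesis using sweepable_commute s_in by blast
qed

end

section \<open>Theta curves\<close>

definition arc_between :: "'a::topological_space \<Rightarrow> 'a \<Rightarrow> 'a set \<Rightarrow> bool" where
  "arc_between a b A \<longleftrightarrow> (\<exists>g. arc g \<and> pathstart g = a \<and> pathfinish g = b \<and> path_image g = A)"

definition bigon :: "'a::topological_space \<Rightarrow> 'a \<Rightarrow> 'a set \<Rightarrow> 'a set \<Rightarrow> bool" where
  "bigon a b A B \<longleftrightarrow> arc_between a b A \<and> arc_between a b B \<and> A \<inter> B = {a, b}"

definition theta_curve :: "'a::topological_space \<Rightarrow> 'a \<Rightarrow> 'a set \<Rightarrow> 'a set \<Rightarrow> 'a set \<Rightarrow> bool" where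
  "theta_curve a b A B C \<longleftrightarrow> bigon a b A B \<and> bigon a b A C \<and> bigon a b B C"

lemma arc_between_path_image:
  "arc g \<Longrightarrow> pathstart g = a \<Longrightarrow> pathfinish g = b \<Longrightarrow> arc_between a b (path_image g)"
  unfolding arc_between_def by blast

lemma arc_between_ends:
  assumes "arc_between a b A" shows "a \<in> A" "b \<in> A" "a \<noteq> b"
  using assms arc_distinct_ends unfolding arc_between_def by (auto dest: arc_distinct_ends)

lemma arc_between_join:
  assumes "arc_between a b A" "arc_between b c B" "A \<inter> B \<subseteq> {b}"
  shows "arc_between a c (A \<union> B)"
proof -
  obtain g h where "arc g" "pathstart g = a" "pathfinish g = b" "path_image g = A"
    and "arc h" "pathstart h = b" "pathfinish h = c" "path_image h = B"
    using assms(1,2) unfolding arc_between_def by blast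
  then show ?thesis
    using assms(3) arc_between_path_image[of "g +++ h" a c] by (simp add: arc_join path_image_join)
qed

lemma connected_arc_between: "arc_between a b A \<Longrightarrow> connected A"
  unfolding arc_between_def using connected_arc_image by blast

lemma compact_arc_between: "arc_between a b A \<Longrightarrow> compact A"
  unfolding arc_between_def using compact_arc_image by blast

lemma connected_open_arc: "arc_between a b A \<Longrightarrow> connected (A - {a, b})"
  unfolding arc_between_def using connected_simple_path_endless arc_imp_simple_path by blast

lemma open_arc_nonempty: "arc_between a b A \<Longrightarrow> A - {a, b} \<noteq> {}"
  unfolding arc_between_def using nonempty_simple_path_endless arc_imp_simple_path by blast

lemma arc_subset_closure_open_arc:
  assumes "arc_between a b A" shows "A \<subseteq> closure (A - {a, b})"
proof -
  obtain g where g: "arc g" "pathstart g = a" "pathfinish g = b" "path_image g = A"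
    using assms unfolding arc_between_def by blast
  have "continuous_on (closure {0<..<1}) g"
    using g(1) arc_imp_path by (auto simp: path_def)
  then have "g ` closure {0<..<1} \<subseteq> closure (g ` {0<..<1})"
    by (intro image_closure_subset) (auto simp: closure_subset)
  then show ?thesis
    using g simple_path_endless[OF arc_imp_simple_path[OF g(1)]] by (simp add: path_image_def)
qed

lemma bigon_commute: "bigon a b A B \<Longrightarrow> bigon a b B A"
  by (auto simp: bigon_def)

lemma bigon_in_union: "bigon a b A B \<Longrightarrow> {a, b} \<subseteq> A \<union> B"
  by (auto simp: bigon_def)

lemma compact_bigon: "bigon a b A B \<Longrightarrow> compact (A \<union> B)"
  by (auto simp: bigon_def intro: compact_arc_between)

lemma bigon_inside_outside:
  fixes A B :: "complex set"
  assumes "bigon a b A B"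
  shows "inside (A \<union> B) \<noteq> {}" "connected (inside (A \<union> B))" "connected (outside (A \<union> B))"
    "open (inside (A \<union> B))" "open (outside (A \<union> B))" "inside (A \<union> B) \<union> outside (A \<union> B) = - (A \<union> B)"
    "frontier (inside (A \<union> B)) = A \<union> B"
proof -
  obtain g h where arcs: "arc g" "pathstart g = a" "pathfinish g = b" "path_image g = A"
    "arc h" "pathstart h = a" "pathfinish h = b" "path_image h = B" and "A \<inter> B = {a, b}"
    using assms unfolding bigon_def arc_between_def by blast
  then have "simple_path (g +++ reversepath h)"
    by (intro simple_path_join_loop) (auto simp: arc_reversepath)
  moreover have "pathfinish (g +++ reversepath h) = pathstart (g +++ reversepath h)"
    using arcs by simp
  moreover have "path_image (g +++ reversepath h) = A \<union> B" using arcs by (simp add: path_image_join)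
  ultimately show "inside (A \<union> B) \<noteq> {}" "connected (inside (A \<union> B))" "connected (outside (A \<union> B))"
    "open (inside (A \<union> B))" "open (outside (A \<union> B))" "inside (A \<union> B) \<union> outside (A \<union> B) = - (A \<union> B)"
    "frontier (inside (A \<union> B)) = A \<union> B"
    using Jordan_inside_outside[of "g +++ reversepath h"] by simp_all
qed

lemma connected_subset_inside_bigon:
  fixes A B :: "complex set"
  assumes "bigon a b A B" "connected T" "T \<inter> (A \<union> B) = {}" "T \<inter> inside (A \<union> B) \<noteq> {}"
  shows "T \<subseteq> inside (A \<union> B)"
proof -
  note jordan = bigon_inside_outside[OF assms(1)]
  have "T \<subseteq> inside (A \<union> B) \<union> outside (A \<union> B)" unfolding jordan(6) using assms(3) by blast
  then show ?thesis
    using connectedD[OF assms(2) jordan(4,5)] inside_Int_outside[of "A \<union> B"] assms(4) by blast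
qed

lemma theta_curve_swap_right: "theta_curve a b A B C \<Longrightarrow> theta_curve a b A C B"
  by (auto simp: theta_curve_def dest: bigon_commute)

lemma theta_curve_rotate: "theta_curve a b A B C \<Longrightarrow> theta_curve a b B C A"
  by (auto simp: theta_curve_def dest: bigon_commute)

lemma theta_open_arc_subset_inside:
  fixes A B C :: "complex set"
  assumes theta: "theta_curve a b A B C" and "C \<inter> inside (A \<union> B) \<noteq> {}"
  shows "C - {a, b} \<subseteq> inside (A \<union> B)"
proof (rule connected_subset_inside_bigon)
  show "bigon a b A B" using theta by (simp add: theta_curve_def)
  show "connected (C - {a, b})"
    using theta by (simp add: theta_curve_def bigon_def connected_open_arc)
  show "(C - {a, b}) \<inter> (A \<union> B) = {}" using theta by (auto simp: theta_curve_def bigon_def)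
  show "(C - {a, b}) \<inter> inside (A \<union> B) \<noteq> {}"
    using assms inside_no_overlap[of "A \<union> B"] bigon_in_union[of a b A B]
    unfolding theta_curve_def by blast
qed

lemma theta_insides_disjoint:
  fixes A B C :: "complex set"
  assumes theta: "theta_curve a b A B C"
    and "A \<inter> inside (B \<union> C) = {}" "C \<inter> inside (A \<union> B) = {}"
  shows "inside (A \<union> B) \<inter> inside (B \<union> C) = {}"
proof (rule ccontr)
  assume meet: "\<not> ?thesis"
  have bigons: "bigon a b A B" "bigon a b B C" using theta by (simp_all add: theta_curve_def)
  note jordan = bigon_inside_outside[OF bigons(1)] bigon_inside_outside[OF bigons(2)]
  have "inside (B \<union> C) \<subseteq> inside (A \<union> B)"
    by (rule connected_subset_inside_bigon[OF bigons(1) jordan(9)])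
       (use assms(2) meet inside_no_overlap[of "B \<union> C"] in blast)+
  moreover have "inside (A \<union> B) \<subseteq> inside (B \<union> C)"
    by (rule connected_subset_inside_bigon[OF bigons(2) jordan(2)])
       (use assms(3) meet inside_no_overlap[of "A \<union> B"] in blast)+
  ultimately have "A \<union> B = B \<union> C" using jordan(7,14) by (metis subset_antisym)
  then have "A - {a, b} = {}" using theta unfolding theta_curve_def bigon_def by blast
  then show False using open_arc_nonempty bigons(1) unfolding bigon_def by blast
qed

text \<open>Otherwise the three bounded regions are disjoint, so a point inside \<open>B \<union> C\<close> and a point
  outside all three arcs are separated neither by \<open>A \<union> B\<close> nor by \<open>A \<union> C\<close>. As these two curves meet
  in the connected set \<open>A\<close>, Janiszewski's theorem applies.\<close>

lemma theta_some_arc_meets_inside: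
  fixes A B C :: "complex set"
  assumes theta: "theta_curve a b A B C"
  shows "A \<inter> inside (B \<union> C) \<noteq> {} \<or> B \<inter> inside (A \<union> C) \<noteq> {} \<or> C \<inter> inside (A \<union> B) \<noteq> {}"
proof (rule ccontr)
  assume "\<not> ?thesis"
  then have empty: "A \<inter> inside (B \<union> C) = {}" "B \<inter> inside (A \<union> C) = {}" "C \<inter> inside (A \<union> B) = {}"
    by auto
  have bigons: "bigon a b A B" "bigon a b A C" "bigon a b B C"
    using theta by (simp_all add: theta_curve_def)
  obtain x where x: "x \<in> inside (B \<union> C)" using bigon_inside_outside(1)[OF bigons(3)] by blast
  have "compact (A \<union> B \<union> C)"
    using compact_Un[OF compact_bigon[OF bigons(1)] compact_bigon[OF bigons(3)]]
    by (simp add: Un_ac)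
  then obtain y where "y \<in> outside (A \<union> B \<union> C)"
    using outside_bounded_nonempty[OF compact_imp_bounded] by blast
  then have y: "y \<in> outside (A \<union> B)" "y \<in> outside (A \<union> C)" "y \<in> outside (B \<union> C)"
    using outside_mono[of _ "A \<union> B \<union> C"] by blast+
  have "x \<notin> inside (A \<union> B)"
    using theta_insides_disjoint[OF theta empty(1,3)] x by blast
  moreover have "x \<notin> inside (A \<union> C)"
    using theta_insides_disjoint[OF theta_curve_swap_right[OF theta]]
      empty x by (simp add: Un_commute) blast
  moreover have "x \<notin> A \<union> B \<union> C" using x empty(1) inside_no_overlap[of "B \<union> C"] by blast
  ultimately have "x \<in> outside (A \<union> B)" "x \<in> outside (A \<union> C)"
    using bigon_inside_outside(6)[OF bigons(1)] bigon_inside_outside(6)[OF bigons(2)] by blast+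
  then have "connected_component (- (A \<union> B)) x y" "connected_component (- (A \<union> C)) x y"
    using y(1,2) bigon_inside_outside(3)[OF bigons(1)] bigon_inside_outside(3)[OF bigons(2)]
      outside_no_overlap unfolding connected_component_def by blast+
  moreover have "connected ((A \<union> B) \<inter> (A \<union> C))"
  proof -
    have "(A \<union> B) \<inter> (A \<union> C) = A" using theta by (auto simp: theta_curve_def bigon_def)
    then show ?thesis using bigons(1) by (auto simp: bigon_def dest: connected_arc_between)
  qed
  ultimately have "connected_component (- ((A \<union> B) \<union> (A \<union> C))) x y"
    using Janiszewski compact_bigon[OF bigons(1)] compact_imp_closed[OF compact_bigon[OF bigons(2)]]
    by blast
  then have "connected_component (- (B \<union> C)) x y" by (rule connected_component_of_subset) auto
  then have "y \<in> inside (B \<union> C)" using x inside_same_component by blast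
  then show False using y(3) inside_Int_outside[of "B \<union> C"] by blast
qed

lemma theta_third_arc_inside:
  fixes A B C :: "complex set"
  assumes theta: "theta_curve a b A B C"
    and "\<not> A - {a, b} \<subseteq> inside (B \<union> C)" "\<not> B - {a, b} \<subseteq> inside (A \<union> C)"
  shows "C - {a, b} \<subseteq> inside (A \<union> B)"
proof -
  have "A \<inter> inside (B \<union> C) = {}"
    using theta_open_arc_subset_inside[OF theta_curve_rotate[OF theta]] assms(2) by blast
  moreover have "B \<inter> inside (A \<union> C) = {}"
    using theta_open_arc_subset_inside[OF theta_curve_swap_right[OF theta]] assms(3) by blast
  ultimately have "C \<inter> inside (A \<union> B) \<noteq> {}" using theta_some_arc_meets_inside[OF theta] by blast
  then show ?thesis by (rule theta_open_arc_subset_inside[OF theta])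
qed

lemma theta_split_inside:
  fixes A B C :: "complex set"
  assumes theta: "theta_curve a b A B C" and inside: "C - {a, b} \<subseteq> inside (A \<union> B)"
  shows "inside (A \<union> C) \<inter> inside (B \<union> C) = {}"
    "inside (A \<union> C) \<union> inside (B \<union> C) \<union> (C - {a, b}) = inside (A \<union> B)"
proof -
  obtain f g h where f: "arc f" "pathstart f = a" "pathfinish f = b" "path_image f = A"
    and g: "arc g" "pathstart g = a" "pathfinish g = b" "path_image g = B"
    and h: "arc h" "pathstart h = a" "pathfinish h = b" "path_image h = C"
    using theta unfolding theta_curve_def bigon_def arc_between_def by blast
  have C: "arc_between a b C" and ints: "A \<inter> B = {a, b}" "A \<inter> C = {a, b}" "B \<inter> C = {a, b}"
    using theta by (simp_all add: theta_curve_def bigon_def)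
  have "C \<inter> inside (A \<union> B) \<noteq> {}" using open_arc_nonempty[OF C] inside by blast
  then show "inside (A \<union> C) \<inter> inside (B \<union> C) = {}"
    "inside (A \<union> C) \<union> inside (B \<union> C) \<union> (C - {a, b}) = inside (A \<union> B)"
    using split_inside_simple_closed_curve[of f a b g h] f g h ints arc_between_ends(3)[OF C]
      arc_imp_simple_path by metis+
qed

lemma chords_of_closed_curve_cross:
  fixes A B C D :: "complex set"
  assumes theta: "theta_curve a b A B C" and C: "C - {a, b} \<subseteq> inside (A \<union> B)"
    and D: "arc_between p q D" "D - {p, q} \<subseteq> inside (A \<union> B)"
    and ends: "p \<in> A - {a, b}" "q \<in> B - {a, b}"
  shows "C \<inter> D \<noteq> {}"
proof
  assume "C \<inter> D = {}"
  note split = theta_split_inside[OF theta C]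
  have bigons: "bigon a b A C" "bigon a b B C" using theta by (simp_all add: theta_curve_def)
  note jordan = bigon_inside_outside[OF bigons(1)] bigon_inside_outside[OF bigons(2)]
  have "D - {p, q} \<subseteq> inside (A \<union> C) \<union> inside (B \<union> C)" using D(2) \<open>C \<inter> D = {}\<close> split(2) by blast
  then have "D - {p, q} \<subseteq> inside (A \<union> C) \<or> D - {p, q} \<subseteq> inside (B \<union> C)"
    using connectedD[OF connected_open_arc[OF D(1)] jordan(4,11)] split(1) by blast
  then have "q \<in> closure (inside (A \<union> C)) \<or> p \<in> closure (inside (B \<union> C))"
    using arc_subset_closure_open_arc[OF D(1)] arc_between_ends[OF D(1)] closure_mono by blast
  moreover have "closure (inside (A \<union> C)) = inside (A \<union> C) \<union> (A \<union> C)"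
    "closure (inside (B \<union> C)) = inside (B \<union> C) \<union> (B \<union> C)"
    using closure_Un_frontier jordan(7,14) by metis+
  moreover have "q \<notin> A \<union> C" "p \<notin> B \<union> C"
    using ends theta by (auto simp: theta_curve_def bigon_def)
  moreover have "p \<notin> inside (A \<union> B)" "q \<notin> inside (A \<union> B)"
    using ends inside_no_overlap[of "A \<union> B"] by blast+
  ultimately show False using split(2) by blast
qed

section \<open>Theta subgraphs\<close>

definition inner_path :: "('a \<Rightarrow> 'a \<Rightarrow> bool) \<Rightarrow> 'a \<Rightarrow> 'a list \<Rightarrow> 'a \<Rightarrow> bool" where
  "inner_path E u P v \<longleftrightarrow> distinct (u # P @ [v]) \<and> successively E (u # P @ [v])"

definition theta :: "('a \<Rightarrow> 'a \<Rightarrow> bool) \<Rightarrow> 'a \<Rightarrow> 'a \<Rightarrow> 'a list \<Rightarrow> 'a list \<Rightarrow> 'a list \<Rightarrow> bool" where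
  "theta E u v P Q R \<longleftrightarrow> inner_path E u P v \<and> inner_path E u Q v \<and> inner_path E u R v \<and>
     set P \<inter> set Q = {} \<and> set P \<inter> set R = {} \<and> set Q \<inter> set R = {}"

definition theta_free :: "('a \<Rightarrow> 'a \<Rightarrow> bool) \<Rightarrow> bool" where
  "theta_free E \<longleftrightarrow> (\<nexists>u v P Q R. theta E u v P Q R \<and> P \<noteq> [] \<and> Q \<noteq> [] \<and> R \<noteq> [])"

lemma path_in_rev:
  assumes "symp E" "path_in E A x p y" shows "path_in E A y (rev p) x"
proof -
  have "(\<lambda>u v. E v u) = E" using assms(1) by (auto simp: fun_eq_iff dest: sympD)
  then have "successively (\<lambda>u v. E v u) p \<longleftrightarrow> successively E p" by (rule arg_cong)
  then show ?thesis using assms(2) by (simp add: path_in_def hd_rev last_rev)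
qed

lemma path_in_suffix: "path_in E A x (ps @ z # qs) y \<Longrightarrow> path_in E A z (z # qs) y"
  by (auto simp: path_in_def successively_append_iff)

lemma path_in_prefix_rev:
  assumes "symp E" "path_in E A x (ps @ z # qs) y" shows "path_in E A z (z # rev ps) x"
  using path_in_suffix[of E A y "rev qs" z "rev ps" x] path_in_rev[OF assms] by simp

lemma connected_set_tripod:
  assumes "symp E" "connected_set E X" "x1 \<in> X" "x2 \<in> X" "x3 \<in> X"
  obtains c P Q R where
    "path_in E X c (c # P) x1" "path_in E X c (c # Q) x2" "path_in E X c (c # R) x3"
    "set P \<inter> set Q = {}" "set P \<inter> set R = {}" "set Q \<inter> set R = {}"
proof -
  obtain xs where xs: "path_in E X x1 xs x2"
    using ex_path_in_if_connected_set[OF assms(2-4)] ..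
  obtain ys where ys: "path_in E X x3 ys x1"
    using ex_path_in_if_connected_set[OF assms(2,5,3)] ..
  have "x1 \<in> set xs" "x1 \<in> set ys"
    using xs ys unfolding path_in_def by (metis hd_in_set last_in_set)+
  then obtain as c bs where split: "ys = as @ c # bs" "c \<in> set xs" "\<forall>a\<in>set as. a \<notin> set xs"
    using split_list_first_prop[of ys "\<lambda>y. y \<in> set xs"] by blast
  then obtain ps qs where xs_eq: "xs = ps @ c # qs" by (meson split_list)
  have "path_in E X c (c # rev ps) x1" "path_in E X c (c # qs) x2"
    using path_in_prefix_rev[OF assms(1)] path_in_suffix xs unfolding xs_eq by metis+
  moreover have "path_in E X c (c # rev as) x3"
    using path_in_prefix_rev[OF assms(1)] ys unfolding split(1) by metis
  moreover have "distinct (ps @ c # qs)" using xs unfolding xs_eq by (simp add: path_in_def)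
  ultimately show thesis
    using split(3) by (intro that[of c "rev ps" qs "rev as"]) (auto simp: xs_eq)
qed

lemma ex_linking_path:
  assumes "symp E" "connected_set E A" "touches E X A" "touches E Y A"
  obtains x y s M t where "x \<in> X" "y \<in> Y" "path_in E A s M t" "E x s" "E t y"
proof -
  obtain x s y t where edges: "x \<in> X" "s \<in> A" "E x s" "y \<in> Y" "t \<in> A" "E y t"
    using assms(3,4) unfolding touches_def by blast
  obtain M where "path_in E A s M t" using ex_path_in_if_connected_set[OF assms(2) edges(2,5)] ..
  then show thesis using that edges sympD[OF assms(1)] by blast
qed

lemma inner_path_join:
  assumes "symp E" and P: "path_in E X u (u # P) x" and M: "path_in E A s M t"
    and Q: "path_in E Y v (v # Q) y" and "E x s" "E t y"
    and disjoint: "disjnt X Y" "disjnt X A" "disjnt Y A"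
  shows "inner_path E u (P @ M @ rev Q) v"
proof -
  have "path_in E Y y (rev (v # Q)) v" using path_in_rev[OF assms(1) Q] .
  then have "successively E ((u # P) @ M @ rev (v # Q))"
    using P M assms(5,6) unfolding path_in_def successively_append_iff by auto
  moreover have "distinct ((u # P) @ M @ rev (v # Q))"
    using P M Q disjoint by (auto simp: path_in_def disjnt_def)
  ultimately show ?thesis by (simp add: inner_path_def)
qed

lemma joined_paths_disjoint:
  assumes "set P \<subseteq> X" "set P' \<subseteq> X" "set M \<subseteq> A" "set M' \<subseteq> A'" "set Q \<subseteq> Y" "set Q' \<subseteq> Y"
    and "set P \<inter> set P' = {}" "set Q \<inter> set Q' = {}" "sorted_wrt disjnt [X, Y, A, A']"
  shows "set (P @ M @ rev Q) \<inter> set (P' @ M' @ rev Q') = {}"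
  using assms by (auto simp: disjnt_iff)

lemma K23_minor_free_if_theta_free:
  assumes "symp E" "theta_free E" shows "K23_minor_free E"
  unfolding K23_minor_free_def
proof (intro notI, elim exE)
  fix X Y A B C assume "K23_model E X Y A B C"
  note model = this[unfolded K23_model_def, simplified]
  obtain x1 y1 s1 M1 t1 where M1: "x1 \<in> X" "y1 \<in> Y" "path_in E A s1 M1 t1" "E x1 s1" "E t1 y1"
    using ex_linking_path[OF assms(1), of A X Y] model by blast
  obtain x2 y2 s2 M2 t2 where M2: "x2 \<in> X" "y2 \<in> Y" "path_in E B s2 M2 t2" "E x2 s2" "E t2 y2"
    using ex_linking_path[OF assms(1), of B X Y] model by blast
  obtain x3 y3 s3 M3 t3 where M3: "x3 \<in> X" "y3 \<in> Y" "path_in E C s3 M3 t3" "E x3 s3" "E t3 y3"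
    using ex_linking_path[OF assms(1), of C X Y] model by blast
  obtain u P1 P2 P3 where
    P: "path_in E X u (u # P1) x1" "path_in E X u (u # P2) x2" "path_in E X u (u # P3) x3"
    and P_disjoint: "set P1 \<inter> set P2 = {}" "set P1 \<inter> set P3 = {}" "set P2 \<inter> set P3 = {}"
    using connected_set_tripod[OF assms(1), of X x1 x2 x3] model M1(1) M2(1) M3(1) by blast
  obtain v Q1 Q2 Q3 where
    Q: "path_in E Y v (v # Q1) y1" "path_in E Y v (v # Q2) y2" "path_in E Y v (v # Q3) y3"
    and Q_disjoint: "set Q1 \<inter> set Q2 = {}" "set Q1 \<inter> set Q3 = {}" "set Q2 \<inter> set Q3 = {}"
    using connected_set_tripod[OF assms(1), of Y y1 y2 y3] model M1(2) M2(2) M3(2) by blast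
  have subsets: "set P1 \<subseteq> X" "set P2 \<subseteq> X" "set P3 \<subseteq> X" "set Q1 \<subseteq> Y" "set Q2 \<subseteq> Y" "set Q3 \<subseteq> Y"
    "set M1 \<subseteq> A" "set M2 \<subseteq> B" "set M3 \<subseteq> C"
    using P Q M1(3) M2(3) M3(3) by (simp_all add: path_in_def)
  have "theta E u v (P1 @ M1 @ rev Q1) (P2 @ M2 @ rev Q2) (P3 @ M3 @ rev Q3)"
    unfolding theta_def
  proof (intro conjI)
    show "inner_path E u (P1 @ M1 @ rev Q1) v" "inner_path E u (P2 @ M2 @ rev Q2) v"
      "inner_path E u (P3 @ M3 @ rev Q3) v"
      using inner_path_join[OF assms(1) P(1) M1(3) Q(1) M1(4,5)]
        inner_path_join[OF assms(1) P(2) M2(3) Q(2) M2(4,5)]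
        inner_path_join[OF assms(1) P(3) M3(3) Q(3) M3(4,5)] model by blast+
    show "set (P1 @ M1 @ rev Q1) \<inter> set (P2 @ M2 @ rev Q2) = {}"
      "set (P1 @ M1 @ rev Q1) \<inter> set (P3 @ M3 @ rev Q3) = {}"
      "set (P2 @ M2 @ rev Q2) \<inter> set (P3 @ M3 @ rev Q3) = {}"
      using joined_paths_disjoint[OF subsets(1,2,7,8,4,5)]
        joined_paths_disjoint[OF subsets(1,3,7,9,4,6)]
        joined_paths_disjoint[OF subsets(2,3,8,9,5,6)] P_disjoint Q_disjoint model by simp_all
  qed
  moreover have "M1 \<noteq> []" "M2 \<noteq> []" "M3 \<noteq> []" using M1(3) M2(3) M3(3) by (simp_all add: path_in_def)
  ultimately show False using assms(2) unfolding theta_free_def by blast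
qed

section \<open>Plane embeddings\<close>

definition adj :: "'a pair_pre_digraph \<Rightarrow> 'a \<Rightarrow> 'a \<Rightarrow> bool" where
  "adj G x y \<longleftrightarrow> (x, y) \<in> parcs G"

lemma (in pair_graph) symp_adj: "symp (adj G)"
  by (auto simp: adj_def arcs_symmetric intro: sympI)

lemma (in pair_graph) adj_irrefl: "\<not> adj G x x"
  using no_loops' by (auto simp: adj_def)

lemma (in pair_graph) adj_in_verts: "adj G x y \<Longrightarrow> x \<in> pverts G \<and> y \<in> pverts G"
  using arc_fst_in_verts arc_snd_in_verts unfolding adj_def by force

lemma vwalk_arcs_if_successively: "successively E xs \<Longrightarrow> (x, y) \<in> set (vwalk_arcs xs) \<Longrightarrow> E x y"
  by (induction xs rule: vwalk_arcs.induct) auto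

lemma ex_incident_vwalk_arc:
  "w \<in> set xs \<Longrightarrow> 2 \<le> length xs \<Longrightarrow> \<exists>(x, y)\<in>set (vwalk_arcs xs). w = x \<or> w = y"
proof (induction xs rule: vwalk_arcs.induct)
  case (3 x y zs)
  then show ?case by (cases zs) auto
qed auto

locale embedded_graph =
  fixes G :: "'a pair_pre_digraph" and pos :: "'a \<Rightarrow> complex" and \<gamma> :: "'a \<times> 'a \<Rightarrow> real \<Rightarrow> complex"
  assumes pair_graph: "pair_graph G" and embedding: "plane_embedding G pos \<gamma>"
begin

lemmas symp_adj = pair_graph.symp_adj[OF pair_graph]
  and adj_irrefl = pair_graph.adj_irrefl[OF pair_graph]
  and adj_in_verts = pair_graph.adj_in_verts[OF pair_graph]

definition trace :: "'a list \<Rightarrow> complex set" where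
  "trace xs = (\<Union>e\<in>set (vwalk_arcs xs). path_image (\<gamma> e))"

lemma pos_eq_iff: "u \<in> pverts G \<Longrightarrow> v \<in> pverts G \<Longrightarrow> pos u = pos v \<longleftrightarrow> u = v"
  using embedding inj_on_eq_iff unfolding plane_embedding_def by metis

lemma edge_drawing:
  assumes "adj G u v"
  shows "arc (\<gamma> (u, v))" "pathstart (\<gamma> (u, v)) = pos u" "pathfinish (\<gamma> (u, v)) = pos v"
    "path_image (\<gamma> (u, v)) \<inter> pos ` pverts G = {pos u, pos v}"
    "path_image (\<gamma> (v, u)) = path_image (\<gamma> (u, v))"
proof -
  have "arc (\<gamma> (u, v)) \<and> pathstart (\<gamma> (u, v)) = pos u \<and> pathfinish (\<gamma> (u, v)) = pos v \<and>
      \<gamma> (v, u) = reversepath (\<gamma> (u, v)) \<and> path_image (\<gamma> (u, v)) \<inter> pos ` pverts G = {pos u, pos v}"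
    using embedding assms unfolding plane_embedding_def adj_def by fast
  then show "arc (\<gamma> (u, v))" "pathstart (\<gamma> (u, v)) = pos u" "pathfinish (\<gamma> (u, v)) = pos v"
    "path_image (\<gamma> (u, v)) \<inter> pos ` pverts G = {pos u, pos v}"
    "path_image (\<gamma> (v, u)) = path_image (\<gamma> (u, v))"
    by simp_all
qed

lemma arc_between_edge: "adj G u v \<Longrightarrow> arc_between (pos u) (pos v) (path_image (\<gamma> (u, v)))"
  using edge_drawing(1-3) by (rule arc_between_path_image)

lemma edges_inter:
  assumes "adj G u v" "adj G x y" "{u, v} \<noteq> {x, y}"
  shows "path_image (\<gamma> (u, v)) \<inter> path_image (\<gamma> (x, y)) \<subseteq> pos ` ({u, v} \<inter> {x, y})"
  using embedding assms unfolding plane_embedding_def adj_def by fast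

lemma trace_Cons_Cons: "trace (x # y # zs) = path_image (\<gamma> (x, y)) \<union> trace (y # zs)"
  by (auto simp: trace_def)

lemma trace_pair: "trace [x, y] = path_image (\<gamma> (x, y))"
  by (simp add: trace_def)

lemma trace_subset_drawing: "successively (adj G) xs \<Longrightarrow> trace xs \<subseteq> drawing G pos \<gamma>"
  using vwalk_arcs_if_successively[of "adj G" xs] by (auto simp: trace_def drawing_def adj_def)

lemma pos_in_trace:
  assumes "successively (adj G) xs" "w \<in> set xs" "2 \<le> length xs" shows "pos w \<in> trace xs"
proof -
  obtain x y where arc: "(x, y) \<in> set (vwalk_arcs xs)" "w = x \<or> w = y"
    using ex_incident_vwalk_arc[OF assms(2,3)] by blast
  have "adj G x y" by (rule vwalk_arcs_if_successively[OF assms(1) arc(1)])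
  then have "pos w \<in> path_image (\<gamma> (x, y))"
    using arc_between_ends(1,2)[OF arc_between_edge] arc(2) by blast
  then show ?thesis unfolding trace_def using arc(1) by blast
qed

lemma trace_inter:
  assumes "successively (adj G) xs" "successively (adj G) ys"
    and "\<And>x y. (x, y) \<in> set (vwalk_arcs xs) \<Longrightarrow> x \<notin> set ys \<or> y \<notin> set ys"
  shows "trace xs \<inter> trace ys \<subseteq> pos ` (set xs \<inter> set ys)"
proof
  fix z assume "z \<in> trace xs \<inter> trace ys"
  then obtain u v x y where uv: "(u, v) \<in> set (vwalk_arcs xs)" "z \<in> path_image (\<gamma> (u, v))"
    and xy: "(x, y) \<in> set (vwalk_arcs ys)" "z \<in> path_image (\<gamma> (x, y))"
    unfolding trace_def by force
  have ends: "u \<in> set xs" "v \<in> set xs" "x \<in> set ys" "y \<in> set ys"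
    using arcs_in_vwalk_arcs[OF uv(1)] arcs_in_vwalk_arcs[OF xy(1)] by auto
  then have "{u, v} \<noteq> {x, y}" using assms(3)[OF uv(1)] by (auto simp: doubleton_eq_iff)
  then have "z \<in> pos ` ({u, v} \<inter> {x, y})"
    using edges_inter vwalk_arcs_if_successively[OF assms(1) uv(1)]
      vwalk_arcs_if_successively[OF assms(2) xy(1)] uv(2) xy(2) by blast
  then show "z \<in> pos ` (set xs \<inter> set ys)" using ends by auto
qed

lemma arc_between_trace:
  assumes "distinct xs" "successively (adj G) xs" "2 \<le> length xs"
  shows "arc_between (pos (hd xs)) (pos (last xs)) (trace xs)"
  using assms
proof (induction xs rule: vwalk_arcs.induct)
  case (3 x y zs)
  have edge: "adj G x y" using "3.prems"(2) by simp
  show ?case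
  proof (cases zs)
    case Nil
    then show ?thesis using arc_between_edge[OF edge] by (simp add: trace_pair)
  next
    case Cons
    have "trace [x, y] \<inter> trace (y # zs) \<subseteq> pos ` (set [x, y] \<inter> set (y # zs))"
      by (rule trace_inter) (use "3.prems" in auto)
    also have "\<dots> \<subseteq> {pos y}" using "3.prems"(1) by auto
    finally have "path_image (\<gamma> (x, y)) \<inter> trace (y # zs) \<subseteq> {pos y}" by (simp add: trace_pair)
    moreover have "arc_between (pos y) (pos (last (y # zs))) (trace (y # zs))"
      using "3.IH" "3.prems" Cons by simp
    ultimately show ?thesis
      using arc_between_join[OF arc_between_edge[OF edge]] by (simp add: trace_Cons_Cons)
  qed
qed simp_all

lemma bigon_trace:
  assumes P: "inner_path (adj G) u P v" "P \<noteq> []" and Q: "inner_path (adj G) u Q v"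
    and disjoint: "set P \<inter> set Q = {}"
  shows "bigon (pos u) (pos v) (trace (u # P @ [v])) (trace (u # Q @ [v]))"
proof -
  note paths = P(1)[unfolded inner_path_def] Q[unfolded inner_path_def]
  have "trace (u # P @ [v]) \<inter> trace (u # Q @ [v]) \<subseteq> pos ` (set (u # P @ [v]) \<inter> set (u # Q @ [v]))"
  proof (rule trace_inter)
    fix x y assume "(x, y) \<in> set (vwalk_arcs (u # P @ [v]))"
    then have "(x, y) = (u, hd P) \<or> (x, y) = (last P, v) \<or> (x, y) \<in> set (vwalk_arcs P)"
      using P(2) set_vwalk_arcs_snoc[of P v] by auto
    then have "x \<in> set P \<or> y \<in> set P" using P(2) arcs_in_vwalk_arcs by fastforce
    then show "x \<notin> set (u # Q @ [v]) \<or> y \<notin> set (u # Q @ [v])" using paths(1) disjoint by auto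
  qed (use paths in simp_all)
  also have "\<dots> \<subseteq> {pos u, pos v}" using disjoint by auto
  finally have "trace (u # P @ [v]) \<inter> trace (u # Q @ [v]) \<subseteq> {pos u, pos v}" .
  moreover have "arc_between (pos u) (pos v) (trace (u # S @ [v]))"
    if "inner_path (adj G) u S v" for S
    using that arc_between_trace[of "u # S @ [v]"] by (simp add: inner_path_def)
  ultimately show ?thesis
    using P(1) Q arc_between_ends(1,2) unfolding bigon_def by blast
qed

lemma theta_curve_trace:
  assumes "theta (adj G) u v P Q R" "P \<noteq> []" "Q \<noteq> []"
  shows "theta_curve (pos u) (pos v)
    (trace (u # P @ [v])) (trace (u # Q @ [v])) (trace (u # R @ [v]))"
  using assms bigon_trace unfolding theta_def theta_curve_def by blast

lemma ex_inner_vertex_on_trace: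
  assumes "inner_path (adj G) u P v" "P \<noteq> []"
  shows "\<exists>w\<in>pverts G. pos w \<in> trace (u # P @ [v]) - {pos u, pos v}"
proof -
  note path = assms(1)[unfolded inner_path_def]
  have "adj G u (hd P)" "adj G (last P) v"
    using path assms(2) by (auto simp: successively_Cons successively_append_iff)
  then have verts: "u \<in> pverts G" "hd P \<in> pverts G" "v \<in> pverts G" using adj_in_verts by blast+
  have "hd P \<in> set P" using assms(2) by simp
  then have "hd P \<noteq> u" "hd P \<noteq> v" "pos (hd P) \<in> trace (u # P @ [v])"
    using path by (auto intro!: pos_in_trace)
  then show ?thesis using verts pos_eq_iff by auto
qed

end

locale outerplane_graph = embedded_graph +
  assumes outer: "pos ` pverts G \<subseteq> frontier (outside (drawing G pos \<gamma>))"
begin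

lemma vertex_not_inside:
  assumes "w \<in> pverts G" "K \<subseteq> drawing G pos \<gamma>" "open (inside K)"
  shows "pos w \<notin> inside K"
proof
  assume "pos w \<in> inside K"
  moreover have "pos w \<in> closure (outside (drawing G pos \<gamma>))"
    using outer assms(1) unfolding frontier_def by blast
  ultimately have "inside K \<inter> outside (drawing G pos \<gamma>) \<noteq> {}"
    using assms(3) by (metis disjoint_iff open_Int_closure_eq_empty)
  then show False using outside_mono[OF assms(2)] inside_Int_outside[of K] by blast
qed

lemma open_trace_not_inside_bigon:
  assumes P: "inner_path (adj G) u P v" "P \<noteq> []"
    and K: "bigon a b K L" "K \<subseteq> drawing G pos \<gamma>" "L \<subseteq> drawing G pos \<gamma>"
  shows "\<not> trace (u # P @ [v]) - {pos u, pos v} \<subseteq> inside (K \<union> L)"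
  using ex_inner_vertex_on_trace[OF P] vertex_not_inside[of _ "K \<union> L"] K(2,3)
    bigon_inside_outside(4)[OF K(1)] by blast

lemma theta_third_trace_inside:
  assumes theta: "theta (adj G) u v P Q R" and "P \<noteq> []" "Q \<noteq> []"
  shows "trace (u # R @ [v]) - {pos u, pos v} \<subseteq> inside (trace (u # P @ [v]) \<union> trace (u # Q @ [v]))"
proof (rule theta_third_arc_inside[OF theta_curve_trace[OF assms]])
  note curve = theta_curve_trace[OF assms, unfolded theta_curve_def]
  have paths: "inner_path (adj G) u P v" "inner_path (adj G) u Q v" "inner_path (adj G) u R v"
    using theta by (simp_all add: theta_def)
  then have "trace (u # S @ [v]) \<subseteq> drawing G pos \<gamma>" if "S \<in> {P, Q, R}" for S
    using that by (auto simp: inner_path_def dest: trace_subset_drawing)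
  then show
    "\<not> trace (u # P @ [v]) - {pos u, pos v} \<subseteq> inside (trace (u # Q @ [v]) \<union> trace (u # R @ [v]))"
    "\<not> trace (u # Q @ [v]) - {pos u, pos v} \<subseteq> inside (trace (u # P @ [v]) \<union> trace (u # R @ [v]))"
    using open_trace_not_inside_bigon paths assms(2,3) curve by (metis insertCI)+
qed

lemma theta_free: "theta_free (adj G)"
  unfolding theta_free_def
proof (intro notI, elim exE conjE)
  fix u v P Q R assume theta: "theta (adj G) u v P Q R" and "P \<noteq> []" "Q \<noteq> []" "R \<noteq> []"
  have "trace (u # P @ [v]) \<subseteq> drawing G pos \<gamma>" "trace (u # Q @ [v]) \<subseteq> drawing G pos \<gamma>"
    using theta trace_subset_drawing by (simp_all add: theta_def inner_path_def)
  then show False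
    using open_trace_not_inside_bigon[of u R v] theta_third_trace_inside[OF theta]
      theta_curve_trace[OF theta] theta \<open>P \<noteq> []\<close> \<open>Q \<noteq> []\<close> \<open>R \<noteq> []\<close>
    unfolding theta_def theta_curve_def by blast
qed

lemma K4_free: "K4_free (adj G)"
  unfolding K4_free_def
proof (intro notI, elim exE conjE)
  fix a b c d
  assume "adj G a b" "adj G a c" "adj G a d" "adj G b c" "adj G b d" "adj G c d"
  note edges = this this[THEN sympD[OF symp_adj]]
  have distinct: "distinct [a, b, c, d]" using edges adj_irrefl by auto
  have theta_ac: "theta (adj G) a c [b] [d] []" and theta_bd: "theta (adj G) b d [a] [c] []"
    using edges distinct by (auto simp: theta_def inner_path_def)
  have same: "trace [b, a, d] \<union> trace [b, c, d] = trace [a, b, c] \<union> trace [a, d, c]"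
    using edges edge_drawing(5) by (auto simp: trace_def)
  have verts: "a \<in> pverts G" "b \<in> pverts G" "c \<in> pverts G" "d \<in> pverts G"
    using edges adj_in_verts by blast+
  have "trace [a, c] \<inter> trace [b, d] \<noteq> {}"
  proof (rule chords_of_closed_curve_cross)
    show "theta_curve (pos a) (pos c) (trace [a, b, c]) (trace [a, d, c]) (trace [a, c])"
      using theta_curve_trace[OF theta_ac] by simp
    show "trace [a, c] - {pos a, pos c} \<subseteq> inside (trace [a, b, c] \<union> trace [a, d, c])"
      using theta_third_trace_inside[OF theta_ac] by simp
    show "arc_between (pos b) (pos d) (trace [b, d])"
      using arc_between_edge edges by (simp add: trace_pair)
    show "trace [b, d] - {pos b, pos d} \<subseteq> inside (trace [a, b, c] \<union> trace [a, d, c])"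
      using theta_third_trace_inside[OF theta_bd] same by simp
    show "pos b \<in> trace [a, b, c] - {pos a, pos c}" "pos d \<in> trace [a, d, c] - {pos a, pos c}"
      using edges distinct verts by (auto simp: pos_eq_iff intro!: pos_in_trace)
  qed
  moreover have "trace [a, c] \<inter> trace [b, d] \<subseteq> pos ` (set [a, c] \<inter> set [b, d])"
    by (rule trace_inter) (use edges distinct in auto)
  ultimately show False using distinct by auto
qed

end

section \<open>Asteroidal triples\<close>

lemma closed_nbhd_eq_nbhd: "closed_nbhd G w = nbhd (adj G) w"
  by (simp add: closed_nbhd_def nbhd_def adj_def)

lemma path_avoiding_nbhd_if_conn_avoiding:
  assumes "conn_avoiding (adj G) (pverts G) a b c"
  shows "path_avoiding_nbhd G a b c"
proof -
  obtain p where p: "path_in (adj G) (pverts G - nbhd (adj G) c) a p b"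
    using ex_path_in_if_conn assms unfolding conn_avoiding_def by metis
  then have "set (vwalk_arcs p) \<subseteq> parcs G"
    using vwalk_arcs_if_successively[of "adj G" p] by (auto simp: path_in_def adj_def)
  then have "vpath p (with_proj G)"
    using p by (auto simp: path_in_def vpath_def vwalk_def arcs_ends_def arc_to_ends_def)
  then show ?thesis
    using p unfolding path_avoiding_nbhd_def closed_nbhd_eq_nbhd path_in_def by blast
qed

lemma not_has_AT_if_AT_free:
  assumes "AT_free G" shows "\<not> has_AT (adj G) (pverts G)"
proof
  assume "has_AT (adj G) (pverts G)"
  then obtain a b c where verts: "a \<in> pverts G" "b \<in> pverts G" "c \<in> pverts G"
    and avoiding: "conn_avoiding (adj G) (pverts G) a b c" "conn_avoiding (adj G) (pverts G) b c a"
      "conn_avoiding (adj G) (pverts G) a c b"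
    unfolding has_AT_def by blast
  have "b \<notin> nbhd (adj G) a" "c \<notin> nbhd (adj G) a" "c \<notin> nbhd (adj G) b"
    using conn_avoiding_in(3,4)[OF avoiding(2)] conn_avoiding_in(4)[OF avoiding(3)] by simp_all
  then have "asteroidal_triple G a b c"
    unfolding asteroidal_triple_def
    using verts avoiding[THEN path_avoiding_nbhd_if_conn_avoiding] by (auto simp: nbhd_def adj_def)
  then show False using assms unfolding AT_free_def by blast
qed

theorem theorem3:
  fixes G :: "'a pair_pre_digraph"
  assumes "pair_graph G"
    and "AT_free G"
    and "outerplanar G"
  shows "B0_VPG G"
proof (cases "pverts G = {}")
  case True
  then show ?thesis by (simp add: B0_VPG_def)
next
  case False
  interpret graph: pair_graph G by (rule assms(1))
  obtain pos \<gamma> where "plane_embedding G pos \<gamma>"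
    "pos ` pverts G \<subseteq> frontier (outside (drawing G pos \<gamma>))"
    using assms(3) unfolding outerplanar_def by blast
  then interpret outerplane_graph G pos \<gamma>
    using assms(1)
    by (intro outerplane_graph.intro embedded_graph.intro outerplane_graph_axioms.intro)
  interpret K23_K4_free "adj G"
    by unfold_locales
      (fact symp_adj adj_irrefl K23_minor_free_if_theta_free[OF symp_adj theta_free] K4_free)+
  obtain s where "s \<in> pverts G" "sweepable (adj G) (pverts G - {s}) (Some s) None"
    using ex_sweepable_from[OF graph.pair_finite_verts False not_has_AT_if_AT_free[OF assms(2)]]
    by blast
  then obtain S where "segment_rep (rel_option (adj G)) (Some ` pverts G) S"
    using segment_rep_if_sweepable_from[OF _ _ symp_adj] by blast
  then show ?thesis by (rule B0_VPG_if_segment_rep) (simp_all add: adj_def)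
qed

end
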